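(* Let $V$ be a complex finite-dimensional vector space and $\tilde V=V\otimes\mathbb{C}[t,t^{-1}]$, graded by $\tilde V_n=V\otimes t^n$, $n\in\mathbb{Z}$. There exists a representation of the $N=2$ superconformal algebra in $W^{\frac{\infty}{2}+*}(\tilde V)$ with central charge $3\dim V$.
   Context: Semi-infinite spaces. Let $V=\bigoplus_{n\in\mathbb{Z}}V_n$ be a graded complex vector space with $\dim V_n<\infty$, $V'=\bigoplus_n V_n^*$ its restricted dual, $V_+=\bigoplus_{n>0}V_n$, $V_-=\bigoplus_{n\le 0}V_n$, $V_-'=\bigoplus_{n\le 0}V_n^*$. On $V\oplus V'$ let $(\cdot,\cdot)$ be the natural skew-symmetric form and $\{\cdot,\cdot\}$ the natural symmetric form ($V$ and $V'$ isotropic, $(x',x)=-(x,x')=x'(x)$, $\{x',x\}=x'(x)$ for $x\in V$, $x'\in V'$). Let $H(V)$ (resp. $C(V)$) be the quotient of the tensor algebra of $V\oplus V'$ by the relations $xy-yx=(x,y)$ (resp. $xy+yx=\{x,y\}$). Let $S^{\frac{\infty}{2}+*}(V)$ (resp. $\Lambda^{\frac{\infty}{2}+*}(V)$) be the $H(V)$-module (resp. $C(V)$-module) induced from the trivial one-dimensional representation of the subalgebra $S^*(V_+\oplus V_-')\subset H(V)$ (resp. $\Lambda^*(V_+\oplus V_-')\subset C(V)$), in which $V_+\oplus V_-'$ acts by $0$. Set $W^{\frac{\infty}{2}+*}(V)=S^{\frac{\infty}{2}+*}(V)\otimes\Lambda^{\frac{\infty}{2}+*}(V)$, a superspace with $\mathbb{Z}/2$-grading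 given by the parity of the $\Lambda$-factor. (This is applied to the graded space $\tilde V$.) The $N=2$ superconformal algebra is the complex Lie superalgebra spanned by even elements $\mathcal{L}_n,H_n$ ($n\in\mathbb{Z}$), odd elements $G^{\pm}_r$ ($r\in\mathbb{Z}+\frac12$) and an even central element $C$, with non-vanishing commutation relations $[\mathcal{L}_n,\mathcal{L}_m]=(n-m)\mathcal{L}_{n+m}+\frac{C}{12}(n^3-n)\delta_{n,-m}$, $[\mathcal{L}_n,H_m]=-mH_{n+m}$, $[\mathcal{L}_n,G^{\pm}_r]=(\frac n2-r)G^{\pm}_{n+r}$, $[G^+_r,G^-_s]=2\mathcal{L}_{r+s}+(r-s)H_{r+s}+\frac{C}{3}(r^2-\frac14)\delta_{r,-s}$, $[H_n,H_m]=\frac{C}{3}n\,\delta_{n,-m}$, $[H_n,G^{\pm}_r]=\pm G^{\pm}_{n+r}$. A representation has central charge $c$ if $C$ acts as multiplication by $c$. *)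

theory Defs
  imports Complex_Main "HOL-Library.Poly_Mapping" "HOL-Library.Product_Plus" "HOL-Library.Z2"
begin

section \<open>Complex vector spaces and algebras\<close>

class scaleC =
  fixes scaleC :: "complex \<Rightarrow> 'a \<Rightarrow> 'a" (infixr "*\<^sub>C" 75)

class complex_vector = scaleC + ab_group_add +
  assumes scaleC_add_right: "a *\<^sub>C (x + y) = a *\<^sub>C x + a *\<^sub>C y"
    and scaleC_add_left: "(a + b) *\<^sub>C x = a *\<^sub>C x + b *\<^sub>C x"
    and scaleC_scaleC: "a *\<^sub>C b *\<^sub>C x = (a * b) *\<^sub>C x"
    and scaleC_one: "1 *\<^sub>C x = x"

text \<open>Unital associative algebras; \<open>0 \<noteq> 1\<close> is not required.\<close>

class complex_algebra = complex_vector + ring + monoid_mult +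
  assumes mult_scaleC_left: "(a *\<^sub>C x) * y = a *\<^sub>C (x * y)"
    and mult_scaleC_right: "x * (a *\<^sub>C y) = a *\<^sub>C (x * y)"

global_interpretation complex_vector?: vector_space "scaleC :: complex \<Rightarrow> 'a \<Rightarrow> 'a::complex_vector"
  defines cdependent_raw_def: cdependent = complex_vector.dependent
    and crepresentation_raw_def: crepresentation = complex_vector.representation
    and csubspace_raw_def: csubspace = complex_vector.subspace
    and cspan_raw_def: cspan = complex_vector.span
    and cextend_basis_raw_def: cextend_basis = complex_vector.extend_basis
    and cdim_raw_def: cdim = complex_vector.dim
  by unfold_locales (simp_all add: scaleC_add_right scaleC_add_left scaleC_scaleC scaleC_one)

hide_const (open)
  complex_vector.dependent
  complex_vector.independent
  complex_vector.representation
  complex_vector.subspace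
  complex_vector.span
  complex_vector.extend_basis
  complex_vector.dim

global_interpretation complex_vector?: vector_space_pair
    "scaleC :: complex \<Rightarrow> 'a \<Rightarrow> 'a::complex_vector" "scaleC :: complex \<Rightarrow> 'b \<Rightarrow> 'b::complex_vector"
  defines cconstruct_raw_def: cconstruct = complex_vector.construct
  by unfold_locales

hide_const (open) complex_vector.construct

abbreviation clinear :: "('a::complex_vector \<Rightarrow> 'b::complex_vector) \<Rightarrow> bool"
  where "clinear \<equiv> Vector_Spaces.linear scaleC scaleC"

class fd_complex_vector = complex_vector +
  assumes finite_dimensional: "\<exists>B. finite B \<and> range (\<lambda>c. \<Sum>b\<in>B. c b *\<^sub>C b) = UNIV"

text \<open>Vector spaces \<open>V = \<Oplus>\<^sub>n V\<^sub>n\<close>, \<open>n \<in> \<int>\<close>, with \<open>dim V\<^sub>n < \<infinity>\<close>; \<open>grade n\<close> is \<open>V\<^sub>n\<close>.\<close>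

class graded_complex_vector = complex_vector +
  fixes grade :: "int \<Rightarrow> 'a set"
  assumes grade_finite_dimensional:
      "\<exists>B. finite B \<and> grade n = range (\<lambda>c. \<Sum>b\<in>B. c b *\<^sub>C b)"
    and grade_direct_sum:
      "\<exists>!f. (\<forall>n. f n \<in> grade n) \<and> finite {n. f n \<noteq> 0} \<and> x = (\<Sum>n | f n \<noteq> 0. f n)"

instantiation complex :: complex_algebra
begin

definition scaleC_complex :: "complex \<Rightarrow> complex \<Rightarrow> complex"
  where [simp]: "scaleC_complex a x = a * x"

instance
  by standard (simp_all add: algebra_simps)

end

instantiation prod :: (complex_vector, complex_vector) complex_vector
begin

definition scaleC_prod :: "complex \<Rightarrow> 'a \<times> 'b \<Rightarrow> 'a \<times> 'b"
  where "scaleC_prod c x = (c *\<^sub>C fst x, c *\<^sub>C snd x)"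

instance
  by standard
    (simp_all add: scaleC_prod_def prod_eq_iff scaleC_add_right scaleC_add_left scaleC_scaleC scaleC_one)

end

instantiation poly_mapping :: (type, complex_vector) complex_vector
begin

lift_definition scaleC_poly_mapping :: "complex \<Rightarrow> ('a \<Rightarrow>\<^sub>0 'b) \<Rightarrow> ('a \<Rightarrow>\<^sub>0 'b)"
  is "\<lambda>c f k. c *\<^sub>C f k"
proof -
  fix c and f :: "'a \<Rightarrow> 'b"
  assume "finite {k. f k \<noteq> 0}"
  then show "finite {k. c *\<^sub>C f k \<noteq> 0}"
    by (rule rev_finite_subset) auto
qed

instance
proof
  fix a b and x y :: "'a \<Rightarrow>\<^sub>0 'b"
  show "a *\<^sub>C (x + y) = a *\<^sub>C x + a *\<^sub>C y"
    by transfer (simp add: scaleC_add_right)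
  show "(a + b) *\<^sub>C x = a *\<^sub>C x + b *\<^sub>C x"
    by transfer (simp add: scaleC_add_left)
  show "a *\<^sub>C b *\<^sub>C x = (a * b) *\<^sub>C x"
    by transfer (simp add: scaleC_scaleC)
  show "1 *\<^sub>C x = x"
    by transfer (simp add: scaleC_one)
qed

end

lemma scaleC_single: "c *\<^sub>C Poly_Mapping.single k x = Poly_Mapping.single k (c *\<^sub>C x)"
  by transfer (auto simp: when_def)

lemma poly_mapping_sum_single: "p = (\<Sum>k\<in>Poly_Mapping.keys p. Poly_Mapping.single k (Poly_Mapping.lookup p k))"
  by (rule poly_mapping_eqI)
    (simp add: lookup_sum lookup_single when_def sum.delta' not_in_keys_iff_lookup_eq_zero)

instance poly_mapping :: (monoid_add, "{complex_algebra, ring_1}") complex_algebra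
proof
  fix a and x y :: "'a \<Rightarrow>\<^sub>0 'b"
  let ?x = "\<lambda>k. Poly_Mapping.single k (Poly_Mapping.lookup x k)" and ?y = "\<lambda>k. Poly_Mapping.single k (Poly_Mapping.lookup y k)"
  have "(a *\<^sub>C (\<Sum>k\<in>Poly_Mapping.keys x. ?x k)) * (\<Sum>k\<in>Poly_Mapping.keys y. ?y k)
      = a *\<^sub>C ((\<Sum>k\<in>Poly_Mapping.keys x. ?x k) * (\<Sum>k\<in>Poly_Mapping.keys y. ?y k))"
    by (simp add: complex_vector.scale_sum_right sum_product scaleC_single mult_single mult_scaleC_left)
  then show "(a *\<^sub>C x) * y = a *\<^sub>C (x * y)"
    by (simp flip: poly_mapping_sum_single)
  have "(\<Sum>k\<in>Poly_Mapping.keys x. ?x k) * (a *\<^sub>C (\<Sum>k\<in>Poly_Mapping.keys y. ?y k))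
      = a *\<^sub>C ((\<Sum>k\<in>Poly_Mapping.keys x. ?x k) * (\<Sum>k\<in>Poly_Mapping.keys y. ?y k))"
    by (simp add: complex_vector.scale_sum_right sum_product scaleC_single mult_single mult_scaleC_right)
  then show "x * (a *\<^sub>C y) = a *\<^sub>C (x * y)"
    by (simp flip: poly_mapping_sum_single)
qed

text \<open>The linear extension of a map defined on a basis.\<close>

definition lin_ext :: "('k \<Rightarrow> 'm::complex_vector) \<Rightarrow> ('k \<Rightarrow>\<^sub>0 complex) \<Rightarrow> 'm"
  where "lin_ext f p = (\<Sum>k\<in>Poly_Mapping.keys p. Poly_Mapping.lookup p k *\<^sub>C f k)"

lemma lin_ext_superset:
  assumes "finite A" "Poly_Mapping.keys p \<subseteq> A"
  shows "lin_ext f p = (\<Sum>k\<in>A. Poly_Mapping.lookup p k *\<^sub>C f k)"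
  unfolding lin_ext_def
  by (rule sum.mono_neutral_left) (use assms in \<open>auto simp: in_keys_iff\<close>)

lemma clinear_lin_ext: "clinear (lin_ext f)"
proof unfold_locales
  fix p q :: "'a \<Rightarrow>\<^sub>0 complex" and c
  have "Poly_Mapping.keys (p + q) \<subseteq> Poly_Mapping.keys p \<union> Poly_Mapping.keys q"
    by (rule keys_add)
  then show "lin_ext f (p + q) = lin_ext f p + lin_ext f q"
    by (simp add: lin_ext_superset[where A = "Poly_Mapping.keys p \<union> Poly_Mapping.keys q"] lookup_add scaleC_add_left sum.distrib)
  have "Poly_Mapping.keys (c *\<^sub>C p) \<subseteq> Poly_Mapping.keys p"
    by (auto simp: in_keys_iff scaleC_poly_mapping.rep_eq)
  then show "lin_ext f (c *\<^sub>C p) = c *\<^sub>C lin_ext f p"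
    by (simp add: lin_ext_superset[where A = "Poly_Mapping.keys p"] scaleC_poly_mapping.rep_eq
        complex_vector.scale_sum_right scaleC_scaleC)
qed

lemmas lin_ext_add = complex_vector.linear_add[OF clinear_lin_ext]
  and lin_ext_scale = complex_vector.linear_scale[OF clinear_lin_ext]

lemma lin_ext_single [simp]: "lin_ext f (Poly_Mapping.single k c) = c *\<^sub>C f k"
  by (cases "c = 0") (simp_all add: lin_ext_def)


section \<open>Quotients, tensor products, tensor algebras\<close>

text \<open>\<open>cong_mod N\<close> is congruence modulo the linear span of \<open>N\<close>.\<close>

definition cong_mod :: "'a::complex_vector set \<Rightarrow> 'a \<Rightarrow> 'a \<Rightarrow> bool"
  where "cong_mod N x y \<longleftrightarrow> x - y \<in> cspan N"

lemma equivp_cong_mod: "equivp (cong_mod N)"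
proof (intro equivpI reflpI sympI transpI)
  fix x y z :: 'a
  show "cong_mod N x x"
    by (simp add: cong_mod_def complex_vector.span_zero)
  show "cong_mod N y x" if "cong_mod N x y"
    using complex_vector.span_neg[OF that[unfolded cong_mod_def]] by (simp add: cong_mod_def)
  show "cong_mod N x z" if "cong_mod N x y" "cong_mod N y z"
    using complex_vector.span_add[OF that[unfolded cong_mod_def]] by (simp add: cong_mod_def)
qed

lemma cong_mod_add: "cong_mod N x x' \<Longrightarrow> cong_mod N y y' \<Longrightarrow> cong_mod N (x + y) (x' + y')"
  unfolding cong_mod_def add_diff_add by (rule complex_vector.span_add)

lemma cong_mod_diff: "cong_mod N x x' \<Longrightarrow> cong_mod N y y' \<Longrightarrow> cong_mod N (x - y) (x' - y')"
  unfolding cong_mod_def by (drule (1) complex_vector.span_diff) (simp add: algebra_simps)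

lemma cong_mod_uminus: "cong_mod N x x' \<Longrightarrow> cong_mod N (- x) (- x')"
  unfolding cong_mod_def by (drule complex_vector.span_neg) (simp add: algebra_simps)

lemma cong_mod_scale: "cong_mod N x x' \<Longrightarrow> cong_mod N (c *\<^sub>C x) (c *\<^sub>C x')"
  unfolding cong_mod_def complex_vector.scale_right_diff_distrib[symmetric]
  by (rule complex_vector.span_scale)

lemma cong_mod_linear:
  assumes "clinear f" "\<And>x. x \<in> N \<Longrightarrow> f x \<in> cspan N'" "cong_mod N x y"
  shows "cong_mod N' (f x) (f y)"
proof -
  interpret f: Vector_Spaces.linear scaleC scaleC f by fact
  have "f z \<in> cspan N'" if "z \<in> cspan N" for z
    using that
    by (induction rule: complex_vector.span_induct_alt)
      (auto simp: f.add f.scale f.zero intro: complex_vector.span_zero complex_vector.span_add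
        complex_vector.span_scale assms(2))
  from this[of "x - y"] show ?thesis
    using assms(3) by (simp add: cong_mod_def f.diff)
qed

text \<open>The two-sided ideal generated by \<open>R\<close> is the linear span of \<open>ideal_gens R\<close>.\<close>

definition ideal_gens :: "'a::complex_algebra set \<Rightarrow> 'a set"
  where "ideal_gens R = {a * r * b | a r b. r \<in> R}"

lemma cong_mod_mult:
  assumes "cong_mod (ideal_gens R) x x'" "cong_mod (ideal_gens R) y y'"
  shows "cong_mod (ideal_gens R) (x * y) (x' * y')"
proof -
  have l: "clinear (\<lambda>z. z * c)" and r: "clinear (\<lambda>z. c * z)" for c :: 'a
    by (unfold_locales; simp add: algebra_simps mult_scaleC_left mult_scaleC_right)+
  have "cong_mod (ideal_gens R) (x * y) (x' * y)"
    using l _ assms(1)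
  proof (rule cong_mod_linear)
    fix z assume "z \<in> ideal_gens R"
    then have "z * y \<in> ideal_gens R"
      unfolding ideal_gens_def by (force simp: mult.assoc)
    then show "z * y \<in> cspan (ideal_gens R)"
      by (rule complex_vector.span_base)
  qed
  moreover have "cong_mod (ideal_gens R) (x' * y) (x' * y')"
    using r _ assms(2)
  proof (rule cong_mod_linear)
    fix z assume "z \<in> ideal_gens R"
    then have "x' * z \<in> ideal_gens R"
      unfolding ideal_gens_def by (force simp flip: mult.assoc)
    then show "x' * z \<in> cspan (ideal_gens R)"
      by (rule complex_vector.span_base)
  qed
  ultimately show ?thesis
    using equivp_cong_mod by (meson equivp_transp)
qed

definition tensor_rels :: "('a::complex_vector \<times> 'b::complex_vector \<Rightarrow>\<^sub>0 complex) set"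
  where "tensor_rels =
    (let e = (\<lambda>x y. Poly_Mapping.single (x, y) 1) in
      {e (x + x') y - e x y - e x' y | x x' y. True}
      \<union> {e x (y + y') - e x y - e x y' | x y y'. True}
      \<union> {e (c *\<^sub>C x) y - c *\<^sub>C e x y | c x y. True}
      \<union> {e x (c *\<^sub>C y) - c *\<^sub>C e x y | c x y. True})"

quotient_type (overloaded) ('a, 'b) tensor =
  "('a::complex_vector \<times> 'b::complex_vector) \<Rightarrow>\<^sub>0 complex" / "cong_mod tensor_rels"
  by (rule equivp_cong_mod)

lift_definition tensor :: "'a::complex_vector \<Rightarrow> 'b::complex_vector \<Rightarrow> ('a, 'b) tensor"
    (infixl "\<otimes>\<^sub>C" 76)
  is "\<lambda>x y. Poly_Mapping.single (x, y) 1" .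

instantiation tensor :: (complex_vector, complex_vector) complex_vector
begin

lift_definition zero_tensor :: "('a, 'b) tensor" is 0 .
lift_definition plus_tensor :: "('a, 'b) tensor \<Rightarrow> ('a, 'b) tensor \<Rightarrow> ('a, 'b) tensor"
  is plus by (rule cong_mod_add)
lift_definition minus_tensor :: "('a, 'b) tensor \<Rightarrow> ('a, 'b) tensor \<Rightarrow> ('a, 'b) tensor"
  is minus by (rule cong_mod_diff)
lift_definition uminus_tensor :: "('a, 'b) tensor \<Rightarrow> ('a, 'b) tensor"
  is uminus by (rule cong_mod_uminus)
lift_definition scaleC_tensor :: "complex \<Rightarrow> ('a, 'b) tensor \<Rightarrow> ('a, 'b) tensor"
  is scaleC by (rule cong_mod_scale)

instance
  by standard
    (transfer; simp add: algebra_simps scaleC_add_right scaleC_add_left scaleC_scaleC scaleC_one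
      equivp_reflp[OF equivp_cong_mod])+

end

text \<open>Left multiplication \<open>b \<otimes> z \<mapsto> (a b) \<otimes> z\<close>.\<close>

lift_definition lmult_tensor ::
    "'a::complex_algebra \<Rightarrow> ('a, 'b::complex_vector) tensor \<Rightarrow> ('a, 'b) tensor"
  is "\<lambda>a. lin_ext (\<lambda>(b, z). Poly_Mapping.single (a * b, z) 1)"
proof -
  fix a :: 'a and p q :: "('a \<times> 'b) \<Rightarrow>\<^sub>0 complex"
  let ?f = "lin_ext (\<lambda>(b, z). Poly_Mapping.single (a * b, z :: 'b) (1::complex))"
  interpret f: Vector_Spaces.linear scaleC scaleC ?f
    by (rule clinear_lin_ext)
  assume "cong_mod tensor_rels p q"
  then show "cong_mod tensor_rels (?f p) (?f q)"
  proof (rule cong_mod_linear[OF clinear_lin_ext, rotated])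
    fix r :: "('a \<times> 'b) \<Rightarrow>\<^sub>0 complex" assume "r \<in> tensor_rels"
    then have "?f r \<in> tensor_rels"
      unfolding tensor_rels_def Let_def
      by (elim UnE CollectE exE conjE)
        (simp add: f.diff f.scale distrib_left mult_scaleC_right scaleC_one; blast)+
    then show "?f r \<in> cspan tensor_rels"
      by (rule complex_vector.span_base)
  qed
qed

text \<open>The free monoid on \<open>'u\<close>, written additively as \<open>Poly_Mapping\<close> requires: \<open>'u free_algebra\<close> is
  then the free associative algebra \<open>\<complex>\<langle>'u\<rangle>\<close>.\<close>

datatype 'u word = Word "'u list"

instantiation word :: (type) monoid_add
begin

definition zero_word :: "'u word" where "zero_word = Word []"

fun plus_word :: "'u word \<Rightarrow> 'u word \<Rightarrow> 'u word"
  where "plus_word (Word us) (Word ws) = Word (us @ ws)"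

instance
proof
  fix a b c :: "'u word"
  show "a + b + c = a + (b + c)" by (cases a; cases b; cases c) simp
  show "0 + a = a" by (cases a) (simp add: zero_word_def)
  show "a + 0 = a" by (cases a) (simp add: zero_word_def)
qed

end

type_synonym 'u free_algebra = "'u word \<Rightarrow>\<^sub>0 complex"

definition free_gen :: "'u \<Rightarrow> 'u free_algebra"
  where "free_gen u = Poly_Mapping.single (Word [u]) 1"

definition tensor_algebra_rels :: "'u::complex_vector free_algebra set"
  where "tensor_algebra_rels =
    {free_gen (u + w) - free_gen u - free_gen w | u w. True}
    \<union> {free_gen (c *\<^sub>C u) - c *\<^sub>C free_gen u | c u. True}"

text \<open>The tensor algebra \<open>T(U)\<close>: the free algebra on the set \<open>U\<close> modulo linearity of \<open>U \<rightarrow> T(U)\<close>.\<close>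

quotient_type (overloaded) 'u tensor_algebra =
  "'u::complex_vector free_algebra" / "cong_mod (ideal_gens tensor_algebra_rels)"
  by (rule equivp_cong_mod)

instantiation tensor_algebra :: (complex_vector) complex_algebra
begin

lift_definition zero_tensor_algebra :: "'a tensor_algebra" is 0 .
lift_definition plus_tensor_algebra :: "'a tensor_algebra \<Rightarrow> 'a tensor_algebra \<Rightarrow> 'a tensor_algebra" is plus by (rule cong_mod_add)
lift_definition minus_tensor_algebra :: "'a tensor_algebra \<Rightarrow> 'a tensor_algebra \<Rightarrow> 'a tensor_algebra" is minus by (rule cong_mod_diff)
lift_definition uminus_tensor_algebra :: "'a tensor_algebra \<Rightarrow> 'a tensor_algebra" is uminus by (rule cong_mod_uminus)
lift_definition scaleC_tensor_algebra :: "complex \<Rightarrow> 'a tensor_algebra \<Rightarrow> 'a tensor_algebra" is scaleC by (rule cong_mod_scale)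
lift_definition one_tensor_algebra :: "'a tensor_algebra" is 1 .
lift_definition times_tensor_algebra :: "'a tensor_algebra \<Rightarrow> 'a tensor_algebra \<Rightarrow> 'a tensor_algebra" is times by (rule cong_mod_mult)

instance
  by standard
    (transfer; simp add: algebra_simps scaleC_add_right scaleC_add_left scaleC_scaleC scaleC_one
      mult_scaleC_left mult_scaleC_right
      equivp_reflp[OF equivp_cong_mod])+

end

lift_definition tensor_gen :: "'u::complex_vector \<Rightarrow> 'u tensor_algebra" is free_gen .


section \<open>Heisenberg and Clifford algebras\<close>

text \<open>The restricted dual \<open>V' = \<Oplus>\<^sub>n V\<^sub>n\<^sup>*\<close>: the linear functionals that vanish on all but finitely many
  \<open>V\<^sub>n\<close>. The summand \<open>V\<^sub>n\<^sup>*\<close> is the space \<open>dual_grade n\<close> of those that vanish on \<open>V\<^sub>m\<close> for \<open>m \<noteq> n\<close>.\<close>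

typedef (overloaded) 'v rdual =
  "{f :: 'v::graded_complex_vector \<Rightarrow> complex. clinear f \<and> finite {n. \<exists>x\<in>grade n. f x \<noteq> 0}}"
  morphisms rdual_apply Abs_rdual
proof -
  have "clinear (\<lambda>_::'v. 0 :: complex)"
    by unfold_locales simp_all
  then show ?thesis
    by (intro exI[of _ "\<lambda>_. 0"]) simp
qed

setup_lifting type_definition_rdual

instantiation rdual :: (graded_complex_vector) complex_vector
begin

lift_definition zero_rdual :: "'a rdual" is "\<lambda>_. 0"
  by (auto intro!: complex_vector.linear_zero)

lift_definition plus_rdual :: "'a rdual \<Rightarrow> 'a rdual \<Rightarrow> 'a rdual" is "\<lambda>f g x. f x + g x"
proof (intro conjI; elim conjE)
  fix f g :: "'a \<Rightarrow> complex"
  assume "clinear f" "clinear g"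
  then show "clinear (\<lambda>x. f x + g x)"
    by (rule complex_vector.linear_compose_add)
  assume "finite {n. \<exists>x\<in>grade n. f x \<noteq> 0}" "finite {n. \<exists>x\<in>grade n. g x \<noteq> 0}"
  from finite_UnI[OF this] show "finite {n. \<exists>x\<in>grade n. f x + g x \<noteq> 0}"
    by (rule rev_finite_subset) force
qed

lift_definition minus_rdual :: "'a rdual \<Rightarrow> 'a rdual \<Rightarrow> 'a rdual" is "\<lambda>f g x. f x - g x"
proof (intro conjI; elim conjE)
  fix f g :: "'a \<Rightarrow> complex"
  assume "clinear f" "clinear g"
  then show "clinear (\<lambda>x. f x - g x)"
    by (rule complex_vector.linear_compose_sub)
  assume "finite {n. \<exists>x\<in>grade n. f x \<noteq> 0}" "finite {n. \<exists>x\<in>grade n. g x \<noteq> 0}"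
  from finite_UnI[OF this] show "finite {n. \<exists>x\<in>grade n. f x - g x \<noteq> 0}"
    by (rule rev_finite_subset) force
qed

lift_definition uminus_rdual :: "'a rdual \<Rightarrow> 'a rdual" is "\<lambda>f x. - f x"
  by (auto intro!: complex_vector.linear_compose_neg)

lift_definition scaleC_rdual :: "complex \<Rightarrow> 'a rdual \<Rightarrow> 'a rdual" is "\<lambda>c f x. c *\<^sub>C f x"
proof (intro conjI; elim conjE)
  fix c and f :: "'a \<Rightarrow> complex"
  assume "clinear f"
  then show "clinear (\<lambda>x. c *\<^sub>C f x)"
    by (rule complex_vector.linear_compose_scale_right)
  assume "finite {n. \<exists>x\<in>grade n. f x \<noteq> 0}"
  then show "finite {n. \<exists>x\<in>grade n. c *\<^sub>C f x \<noteq> 0}"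
    by (rule rev_finite_subset) auto
qed

instance
  by standard (transfer; simp add: fun_eq_iff algebra_simps)+

end

definition dual_grade :: "int \<Rightarrow> 'v::graded_complex_vector rdual set"
  where "dual_grade n = {f. \<forall>m. m \<noteq> n \<longrightarrow> (\<forall>x\<in>grade m. rdual_apply f x = 0)}"

type_synonym 'v double = "'v \<times> 'v rdual"

definition skew_form :: "'v::graded_complex_vector double \<Rightarrow> 'v double \<Rightarrow> complex"
  where "skew_form = (\<lambda>(x, x') (y, y'). rdual_apply x' y - rdual_apply y' x)"

definition sym_form :: "'v::graded_complex_vector double \<Rightarrow> 'v double \<Rightarrow> complex"
  where "sym_form = (\<lambda>(x, x') (y, y'). rdual_apply x' y + rdual_apply y' x)"

definition heisenberg_rels :: "'v::graded_complex_vector double tensor_algebra set"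
  where "heisenberg_rels =
    {tensor_gen u * tensor_gen w - tensor_gen w * tensor_gen u - skew_form u w *\<^sub>C 1 | u w. True}"

definition clifford_rels :: "'v::graded_complex_vector double tensor_algebra set"
  where "clifford_rels =
    {tensor_gen u * tensor_gen w + tensor_gen w * tensor_gen u - sym_form u w *\<^sub>C 1 | u w. True}"

quotient_type (overloaded) 'v heisenberg =
  "'v::graded_complex_vector double tensor_algebra" / "cong_mod (ideal_gens heisenberg_rels)"
  by (rule equivp_cong_mod)

instantiation heisenberg :: (graded_complex_vector) complex_algebra
begin

lift_definition zero_heisenberg :: "'a heisenberg" is 0 .
lift_definition plus_heisenberg :: "'a heisenberg \<Rightarrow> 'a heisenberg \<Rightarrow> 'a heisenberg" is plus by (rule cong_mod_add)
lift_definition minus_heisenberg :: "'a heisenberg \<Rightarrow> 'a heisenberg \<Rightarrow> 'a heisenberg" is minus by (rule cong_mod_diff)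
lift_definition uminus_heisenberg :: "'a heisenberg \<Rightarrow> 'a heisenberg" is uminus by (rule cong_mod_uminus)
lift_definition scaleC_heisenberg :: "complex \<Rightarrow> 'a heisenberg \<Rightarrow> 'a heisenberg" is scaleC by (rule cong_mod_scale)
lift_definition one_heisenberg :: "'a heisenberg" is 1 .
lift_definition times_heisenberg :: "'a heisenberg \<Rightarrow> 'a heisenberg \<Rightarrow> 'a heisenberg" is times by (rule cong_mod_mult)

instance
  by standard
    (transfer; simp add: algebra_simps scaleC_add_right scaleC_add_left scaleC_scaleC scaleC_one
      mult_scaleC_left mult_scaleC_right
      equivp_reflp[OF equivp_cong_mod])+

end

quotient_type (overloaded) 'v clifford =
  "'v::graded_complex_vector double tensor_algebra" / "cong_mod (ideal_gens clifford_rels)"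
  by (rule equivp_cong_mod)

instantiation clifford :: (graded_complex_vector) complex_algebra
begin

lift_definition zero_clifford :: "'a clifford" is 0 .
lift_definition plus_clifford :: "'a clifford \<Rightarrow> 'a clifford \<Rightarrow> 'a clifford" is plus by (rule cong_mod_add)
lift_definition minus_clifford :: "'a clifford \<Rightarrow> 'a clifford \<Rightarrow> 'a clifford" is minus by (rule cong_mod_diff)
lift_definition uminus_clifford :: "'a clifford \<Rightarrow> 'a clifford" is uminus by (rule cong_mod_uminus)
lift_definition scaleC_clifford :: "complex \<Rightarrow> 'a clifford \<Rightarrow> 'a clifford" is scaleC by (rule cong_mod_scale)
lift_definition one_clifford :: "'a clifford" is 1 .
lift_definition times_clifford :: "'a clifford \<Rightarrow> 'a clifford \<Rightarrow> 'a clifford" is times by (rule cong_mod_mult)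

instance
  by standard
    (transfer; simp add: algebra_simps scaleC_add_right scaleC_add_left scaleC_scaleC scaleC_one
      mult_scaleC_left mult_scaleC_right
      equivp_reflp[OF equivp_cong_mod])+

end

definition heisenberg_gen :: "'v::graded_complex_vector double \<Rightarrow> 'v heisenberg"
  where "heisenberg_gen u = abs_heisenberg (tensor_gen u)"

definition clifford_gen :: "'v::graded_complex_vector double \<Rightarrow> 'v clifford"
  where "clifford_gen u = abs_clifford (tensor_gen u)"


section \<open>Semi-infinite spaces\<close>

text \<open>\<open>V\<^sub>+ \<oplus> V\<^sub>-'\<close> as a subspace of \<open>V \<oplus> V'\<close>\<close>

definition annihilators :: "'v::graded_complex_vector double set"
  where "annihilators = cspan (\<Union>n\<in>{0<..}. grade n) \<times> cspan (\<Union>n\<in>{..0}. dual_grade n)"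

text \<open>The graph of the one-dimensional representation in which \<open>U\<close> acts by \<open>0\<close> of the unital subalgebra
  generated by \<open>U\<close>: \<open>trivial_rep U a c\<close> holds iff \<open>a\<close> is in this subalgebra and acts as the scalar \<open>c\<close>.\<close>

inductive trivial_rep :: "'a::complex_algebra set \<Rightarrow> 'a \<Rightarrow> complex \<Rightarrow> bool" for U
  where
    "u \<in> U \<Longrightarrow> trivial_rep U u 0"
  | "trivial_rep U 1 1"
  | "trivial_rep U a c \<Longrightarrow> trivial_rep U b d \<Longrightarrow> trivial_rep U (a + b) (c + d)"
  | "trivial_rep U a c \<Longrightarrow> trivial_rep U b d \<Longrightarrow> trivial_rep U (a * b) (c * d)"
  | "trivial_rep U a c \<Longrightarrow> trivial_rep U (z *\<^sub>C a) (z *\<^sub>C c)"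

text \<open>The induced module \<open>A \<otimes>\<^bsub>B\<^esub> \<complex>\<close>, for \<open>B \<subseteq> A\<close> the subalgebra generated by \<open>U\<close>, is the quotient of
  \<open>A \<otimes> \<complex>\<close> by the span of \<open>induction_rels U\<close>.\<close>

definition induction_rels :: "'a::complex_algebra set \<Rightarrow> ('a, complex) tensor set"
  where "induction_rels U =
    {(h * b) \<otimes>\<^sub>C z - h \<otimes>\<^sub>C (c * z) | h b z c. trivial_rep U b c}"

lemma clinear_lmult_tensor: "clinear (lmult_tensor a)"
proof unfold_locales
  fix p q :: "('a, 'b) tensor" and c
  show "lmult_tensor a (p + q) = lmult_tensor a p + lmult_tensor a q"
    by transfer (simp add: lin_ext_add equivp_reflp[OF equivp_cong_mod])
  show "lmult_tensor a (c *\<^sub>C p) = c *\<^sub>C lmult_tensor a p"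
    by transfer (simp add: lin_ext_scale equivp_reflp[OF equivp_cong_mod])
qed

lemma lmult_tensor_simple [simp]: "lmult_tensor a (b \<otimes>\<^sub>C z) = (a * b) \<otimes>\<^sub>C z"
  by transfer (simp add: scaleC_one equivp_reflp[OF equivp_cong_mod])

lemma cong_mod_lmult_tensor:
  assumes "cong_mod (induction_rels U) p q"
  shows "cong_mod (induction_rels U) (lmult_tensor a p) (lmult_tensor a q)"
  using clinear_lmult_tensor _ assms
proof (rule cong_mod_linear)
  interpret f: Vector_Spaces.linear scaleC scaleC "lmult_tensor a :: ('a, complex) tensor \<Rightarrow> _"
    by (rule clinear_lmult_tensor)
  fix r assume "r \<in> induction_rels U"
  then obtain h b z c where "r = (h * b) \<otimes>\<^sub>C z - h \<otimes>\<^sub>C (c * z)" "trivial_rep U b c"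
    by (auto simp: induction_rels_def)
  then have "lmult_tensor a r = ((a * h) * b) \<otimes>\<^sub>C z - (a * h) \<otimes>\<^sub>C (c * z)" "trivial_rep U b c"
    by (simp_all add: f.diff mult.assoc)
  then have "lmult_tensor a r \<in> induction_rels U"
    unfolding induction_rels_def by blast
  then show "lmult_tensor a r \<in> cspan (induction_rels U)"
    by (rule complex_vector.span_base)
qed

text \<open>\<open>S\<^bsup>\<infinity>/2+*\<^esup>(V)\<close> and \<open>\<Lambda>\<^bsup>\<infinity>/2+*\<^esup>(V)\<close>\<close>

quotient_type (overloaded) 'v semi_inf_sym =
  "('v::graded_complex_vector heisenberg, complex) tensor"
    / "cong_mod (induction_rels (heisenberg_gen ` annihilators))"
  by (rule equivp_cong_mod)

quotient_type (overloaded) 'v semi_inf_ext =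
  "('v::graded_complex_vector clifford, complex) tensor"
    / "cong_mod (induction_rels (clifford_gen ` annihilators))"
  by (rule equivp_cong_mod)

instantiation semi_inf_sym :: (graded_complex_vector) complex_vector
begin

lift_definition zero_semi_inf_sym :: "'a semi_inf_sym" is 0 .
lift_definition plus_semi_inf_sym :: "'a semi_inf_sym \<Rightarrow> 'a semi_inf_sym \<Rightarrow> 'a semi_inf_sym" is plus by (rule cong_mod_add)
lift_definition minus_semi_inf_sym :: "'a semi_inf_sym \<Rightarrow> 'a semi_inf_sym \<Rightarrow> 'a semi_inf_sym" is minus by (rule cong_mod_diff)
lift_definition uminus_semi_inf_sym :: "'a semi_inf_sym \<Rightarrow> 'a semi_inf_sym" is uminus by (rule cong_mod_uminus)
lift_definition scaleC_semi_inf_sym :: "complex \<Rightarrow> 'a semi_inf_sym \<Rightarrow> 'a semi_inf_sym" is scaleC by (rule cong_mod_scale)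

instance
  by standard
    (transfer; simp add: algebra_simps scaleC_add_right scaleC_add_left scaleC_scaleC scaleC_one
      equivp_reflp[OF equivp_cong_mod])+

end

instantiation semi_inf_ext :: (graded_complex_vector) complex_vector
begin

lift_definition zero_semi_inf_ext :: "'a semi_inf_ext" is 0 .
lift_definition plus_semi_inf_ext :: "'a semi_inf_ext \<Rightarrow> 'a semi_inf_ext \<Rightarrow> 'a semi_inf_ext" is plus by (rule cong_mod_add)
lift_definition minus_semi_inf_ext :: "'a semi_inf_ext \<Rightarrow> 'a semi_inf_ext \<Rightarrow> 'a semi_inf_ext" is minus by (rule cong_mod_diff)
lift_definition uminus_semi_inf_ext :: "'a semi_inf_ext \<Rightarrow> 'a semi_inf_ext" is uminus by (rule cong_mod_uminus)
lift_definition scaleC_semi_inf_ext :: "complex \<Rightarrow> 'a semi_inf_ext \<Rightarrow> 'a semi_inf_ext" is scaleC by (rule cong_mod_scale)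

instance
  by standard
    (transfer; simp add: algebra_simps scaleC_add_right scaleC_add_left scaleC_scaleC scaleC_one
      equivp_reflp[OF equivp_cong_mod])+

end

lifting_forget heisenberg.lifting
lifting_forget clifford.lifting

lift_definition heisenberg_act ::
    "'v::graded_complex_vector heisenberg \<Rightarrow> 'v semi_inf_sym \<Rightarrow> 'v semi_inf_sym"
  is lmult_tensor by (rule cong_mod_lmult_tensor)

lift_definition clifford_act ::
    "'v::graded_complex_vector clifford \<Rightarrow> 'v semi_inf_ext \<Rightarrow> 'v semi_inf_ext"
  is lmult_tensor by (rule cong_mod_lmult_tensor)

lift_definition ext_vacuum :: "'v::graded_complex_vector semi_inf_ext" is "1 \<otimes>\<^sub>C 1" .

lifting_update heisenberg.lifting
lifting_update clifford.lifting

text \<open>The \<open>\<int>/2\<close>-grading for which the vacuum is even and the elements of \<open>V \<oplus> V'\<close> are odd operators\<close>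

definition ext_part :: "bit \<Rightarrow> 'v::graded_complex_vector semi_inf_ext set"
  where "ext_part i =
    cspan {clifford_act (prod_list (map clifford_gen us)) ext_vacuum | us. of_nat (length us) = i}"

type_synonym 'v weil = "('v semi_inf_sym, 'v semi_inf_ext) tensor"

definition weil_part :: "bit \<Rightarrow> 'v::graded_complex_vector weil set"
  where "weil_part i = cspan {s \<otimes>\<^sub>C l | s l. l \<in> ext_part i}"


section \<open>Loop spaces\<close>

text \<open>\<open>V \<otimes> \<complex>[t, t\<^bsup>-1\<^esup>]\<close> as the space of Laurent polynomials \<open>\<Sum>\<^sub>n v\<^sub>n t\<^sup>n\<close> with coefficients \<open>v\<^sub>n \<in> V\<close>\<close>

typedef (overloaded) 'v loop = "{f :: int \<Rightarrow> 'v::complex_vector. finite {n. f n \<noteq> 0}}"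
  morphisms loop_coeff Abs_loop
  by (rule exI[of _ "\<lambda>_. 0"]) simp

setup_lifting type_definition_loop

instantiation loop :: (complex_vector) complex_vector
begin

lift_definition zero_loop :: "'a loop" is "\<lambda>_. 0"
  by simp

lift_definition plus_loop :: "'a loop \<Rightarrow> 'a loop \<Rightarrow> 'a loop" is "\<lambda>f g n. f n + g n"
proof -
  fix f g :: "int \<Rightarrow> 'a"
  assume "finite {n. f n \<noteq> 0}" "finite {n. g n \<noteq> 0}"
  from finite_UnI[OF this] show "finite {n. f n + g n \<noteq> 0}"
    by (rule rev_finite_subset) auto
qed

lift_definition minus_loop :: "'a loop \<Rightarrow> 'a loop \<Rightarrow> 'a loop" is "\<lambda>f g n. f n - g n"
proof -
  fix f g :: "int \<Rightarrow> 'a"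
  assume "finite {n. f n \<noteq> 0}" "finite {n. g n \<noteq> 0}"
  from finite_UnI[OF this] show "finite {n. f n - g n \<noteq> 0}"
    by (rule rev_finite_subset) auto
qed

lift_definition uminus_loop :: "'a loop \<Rightarrow> 'a loop" is "\<lambda>f n. - f n"
  by simp

lift_definition scaleC_loop :: "complex \<Rightarrow> 'a loop \<Rightarrow> 'a loop" is "\<lambda>c f n. c *\<^sub>C f n"
proof -
  fix c and f :: "int \<Rightarrow> 'a"
  assume "finite {n. f n \<noteq> 0}"
  then show "finite {n. c *\<^sub>C f n \<noteq> 0}"
    by (rule rev_finite_subset) auto
qed

instance
  by standard
    (transfer; simp add: fun_eq_iff algebra_simps scaleC_add_right scaleC_add_left scaleC_scaleC
      scaleC_one)+

end

text \<open>\<open>v t\<^sup>n\<close>\<close>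

lift_definition loop_monom :: "int \<Rightarrow> 'v::complex_vector \<Rightarrow> 'v loop" is "\<lambda>n v m. if m = n then v else 0"
  by simp

lemma loop_eq_iff: "x = y \<longleftrightarrow> (\<forall>n. loop_coeff x n = loop_coeff y n)"
  unfolding loop_coeff_inject[symmetric] by (rule fun_eq_iff)

lemma clinear_loop_monom: "clinear (loop_monom n)"
  by unfold_locales (transfer; simp add: fun_eq_iff)+

lemma loop_coeff_sum: "loop_coeff (\<Sum>a\<in>A. f a) n = (\<Sum>a\<in>A. loop_coeff (f a) n)"
  by (induction A rule: infinite_finite_induct) (simp_all add: zero_loop.rep_eq plus_loop.rep_eq)

instantiation loop :: (fd_complex_vector) graded_complex_vector
begin

definition grade_loop :: "int \<Rightarrow> 'a loop set"
  where "grade_loop n = range (loop_monom n)"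

instance
proof
  fix n :: int and x :: "'a loop"
  obtain B :: "'a set" where B: "finite B" "cspan B = UNIV"
    using finite_dimensional[where 'a = 'a] by (auto simp: complex_vector.span_finite)
  interpret m: Vector_Spaces.linear scaleC scaleC "loop_monom n :: 'a \<Rightarrow> _"
    by (rule clinear_loop_monom)
  have "grade n = cspan (loop_monom n ` B)"
    unfolding grade_loop_def
    unfolding complex_vector.linear_span_image[OF clinear_loop_monom] B(2) ..
  then show "\<exists>B :: 'a loop set. finite B \<and> grade n = range (\<lambda>c. \<Sum>b\<in>B. c b *\<^sub>C b)"
    using B(1) by (intro exI[of _ "loop_monom n ` B"]) (simp add: complex_vector.span_finite)
  define f where "f k = loop_monom k (loop_coeff x k)" for k
  have coeff_f: "loop_coeff (f k) m = (if m = k then loop_coeff x k else 0)" for k m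
    by (simp add: f_def loop_monom.rep_eq)
  have f0: "f k = 0 \<longleftrightarrow> loop_coeff x k = 0" for k
    unfolding loop_eq_iff coeff_f zero_loop.rep_eq by auto
  show "\<exists>!f. (\<forall>n. f n \<in> grade n) \<and> finite {n. f n \<noteq> 0} \<and> x = (\<Sum>n | f n \<noteq> 0. f n)"
  proof (rule ex1I[of _ f], intro conjI allI)
    show "f k \<in> grade k" for k
      by (simp add: f_def grade_loop_def)
    show fin: "finite {n. f n \<noteq> 0}"
      using loop_coeff[of x] by (simp add: f0)
    have "loop_coeff x m = loop_coeff (\<Sum>n | f n \<noteq> 0. f n) m" for m
      using fin by (auto simp: loop_coeff_sum coeff_f f0)
    then show "x = (\<Sum>n | f n \<noteq> 0. f n)"
      by (intro iffD2[OF loop_eq_iff] allI)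
  next
    fix g :: "int \<Rightarrow> 'a loop"
    assume "(\<forall>n. g n \<in> grade n) \<and> finite {n. g n \<noteq> 0} \<and> x = (\<Sum>n | g n \<noteq> 0. g n)"
    then have g: "\<And>n. g n \<in> range (loop_monom n)" "finite {n. g n \<noteq> 0}" "x = (\<Sum>n | g n \<noteq> 0. g n)"
      by (auto simp: grade_loop_def)
    from g(1) have "\<forall>k. \<exists>v. g k = loop_monom k v"
      by blast
    then obtain v where v: "g k = loop_monom k (v k)" for k
      by metis
    have coeff_g: "loop_coeff (g k) m = (if m = k then v k else 0)" for k m
      by (simp add: v loop_monom.rep_eq)
    have g0: "g k = 0 \<longleftrightarrow> v k = 0" for k
      unfolding loop_eq_iff coeff_g zero_loop.rep_eq by auto
    have "loop_coeff x m = v m" for m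
    proof -
      have "loop_coeff x m = (\<Sum>n | g n \<noteq> 0. loop_coeff (g n) m)"
        by (subst g(3)) (rule loop_coeff_sum)
      then show ?thesis
        using g(2) by (auto simp: coeff_g g0)
    qed
    then show "g = f"
      by (simp add: fun_eq_iff v f_def)
  qed
qed

end


section \<open>The \<open>N = 2\<close> superconformal algebra\<close>

text \<open>\<open>Gplus k\<close> and \<open>Gminus k\<close> are \<open>G\<^sup>+\<^sub>r\<close> and \<open>G\<^sup>-\<^sub>r\<close> for the half-integer \<open>r = k + 1/2\<close>.\<close>

datatype n2_gen = Lgen int | Hgen int | Gplus int | Gminus int | Cgen

type_synonym n2 = "n2_gen \<Rightarrow>\<^sub>0 complex"

abbreviation n2_basis :: "n2_gen \<Rightarrow> n2"
  where "n2_basis a \<equiv> Poly_Mapping.single a 1"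

definition half_int :: "int \<Rightarrow> complex"
  where "half_int k = of_int k + 1 / 2"

fun n2_gen_parity :: "n2_gen \<Rightarrow> bit"
  where
    "n2_gen_parity (Gplus k) = 1"
  | "n2_gen_parity (Gminus k) = 1"
  | "n2_gen_parity _ = 0"

definition n2_part :: "bit \<Rightarrow> n2 set"
  where "n2_part i = cspan {n2_basis a | a. n2_gen_parity a = i}"

text \<open>In \<open>[G\<^sup>+\<^sub>r, G\<^sup>-\<^sub>s]\<close> with \<open>r = k + 1/2\<close> and \<open>s = l + 1/2\<close> one has \<open>r + s = k + l + 1\<close>.\<close>

definition n2_bracket_Gplus_Gminus :: "int \<Rightarrow> int \<Rightarrow> n2"
  where "n2_bracket_Gplus_Gminus k l =
    2 *\<^sub>C n2_basis (Lgen (k + l + 1))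
    + (half_int k - half_int l) *\<^sub>C n2_basis (Hgen (k + l + 1))
    + (if k + l + 1 = 0 then (1 / 3 * ((half_int k)\<^sup>2 - 1 / 4)) *\<^sub>C n2_basis Cgen else 0)"

fun n2_gen_bracket :: "n2_gen \<Rightarrow> n2_gen \<Rightarrow> n2"
  where
    "n2_gen_bracket (Lgen n) (Lgen m) = of_int (n - m) *\<^sub>C n2_basis (Lgen (n + m))
      + (if n = - m then (1 / 12 * (of_int n ^ 3 - of_int n)) *\<^sub>C n2_basis Cgen else 0)"
  | "n2_gen_bracket (Lgen n) (Hgen m) = - of_int m *\<^sub>C n2_basis (Hgen (n + m))"
  | "n2_gen_bracket (Hgen m) (Lgen n) = of_int m *\<^sub>C n2_basis (Hgen (n + m))"
  | "n2_gen_bracket (Lgen n) (Gplus k) = (of_int n / 2 - half_int k) *\<^sub>C n2_basis (Gplus (n + k))"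
  | "n2_gen_bracket (Gplus k) (Lgen n) = - (of_int n / 2 - half_int k) *\<^sub>C n2_basis (Gplus (n + k))"
  | "n2_gen_bracket (Lgen n) (Gminus k) = (of_int n / 2 - half_int k) *\<^sub>C n2_basis (Gminus (n + k))"
  | "n2_gen_bracket (Gminus k) (Lgen n) = - (of_int n / 2 - half_int k) *\<^sub>C n2_basis (Gminus (n + k))"
  | "n2_gen_bracket (Gplus k) (Gminus l) = n2_bracket_Gplus_Gminus k l"
  | "n2_gen_bracket (Gminus l) (Gplus k) = n2_bracket_Gplus_Gminus k l"
  | "n2_gen_bracket (Hgen n) (Hgen m) = (if n = - m then (1 / 3 * of_int n) *\<^sub>C n2_basis Cgen else 0)"
  | "n2_gen_bracket (Hgen n) (Gplus k) = n2_basis (Gplus (n + k))"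
  | "n2_gen_bracket (Gplus k) (Hgen n) = - n2_basis (Gplus (n + k))"
  | "n2_gen_bracket (Hgen n) (Gminus k) = - n2_basis (Gminus (n + k))"
  | "n2_gen_bracket (Gminus k) (Hgen n) = n2_basis (Gminus (n + k))"
  | "n2_gen_bracket _ _ = 0"

definition n2_bracket :: "n2 \<Rightarrow> n2 \<Rightarrow> n2"
  where "n2_bracket x y = lin_ext (\<lambda>a. lin_ext (n2_gen_bracket a) y) x"


section \<open>Representations of Lie superalgebras\<close>

text \<open>A homomorphism \<open>\<rho> : \<g> \<rightarrow> End W\<close> of Lie superalgebras; \<open>g i\<close> and \<open>W i\<close> are the homogeneous
  components of \<open>\<g>\<close> and \<open>W\<close>, and \<open>br\<close> is the bracket of \<open>\<g>\<close>.\<close>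

definition superrep ::
    "(bit \<Rightarrow> 'g::complex_vector set) \<Rightarrow> ('g \<Rightarrow> 'g \<Rightarrow> 'g) \<Rightarrow> (bit \<Rightarrow> 'w::complex_vector set)
      \<Rightarrow> ('g \<Rightarrow> 'w \<Rightarrow> 'w) \<Rightarrow> bool"
  where "superrep g br W \<rho> \<longleftrightarrow>
    (\<forall>x. clinear (\<rho> x)) \<and>
    (\<forall>w. clinear (\<lambda>x. \<rho> x w)) \<and>
    (\<forall>i j x w. x \<in> g i \<and> w \<in> W j \<longrightarrow> \<rho> x w \<in> W (i + j)) \<and>
    (\<forall>i j x y w. x \<in> g i \<and> y \<in> g j \<longrightarrow>
      \<rho> (br x y) w = \<rho> x (\<rho> y w) - (if i = 1 \<and> j = 1 then - 1 else 1) *\<^sub>C \<rho> y (\<rho> x w))"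

definition n2_representation :: "(bit \<Rightarrow> 'w::complex_vector set) \<Rightarrow> (n2 \<Rightarrow> 'w \<Rightarrow> 'w) \<Rightarrow> bool"
  where "n2_representation = superrep n2_part n2_bracket"

definition has_central_charge :: "(n2 \<Rightarrow> 'w::complex_vector \<Rightarrow> 'w) \<Rightarrow> complex \<Rightarrow> bool"
  where "has_central_charge \<rho> c \<longleftrightarrow> (\<forall>w. \<rho> (n2_basis Cgen) w = c *\<^sub>C w)"

end

theory Submission
  imports Defs
begin

text \<open>
  The algebra acts by normally ordered quadratic expressions in the modes of the bosonic and fermionic
  fields on the Fock module; on one particle states, with \<open>V\<close> replaced by \<open>\<complex>\<close>, these are the
  endomorphisms of \<open>\<complex>[t, t\<^bsup>-1\<^esup>] \<otimes> \<complex>\<^bsup>1|1\<^esup>\<close> by which the centreless \<open>N = 2\<close> algebra acts in the chiral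
  de Rham complex, with bosons of weights \<open>0\<close> and \<open>1\<close> and fermions of weight \<open>1/2\<close>.
  The commutator of two quadratic expressions and the quadratic expression of the commutator
  supercommute with the modes up to the same terms, so that their difference \<open>D\<close> is determined by
  its value on the cyclic vector. If \<open>D\<close> changes the energy, then \<open>D vac\<close> is annihilated by all
  annihilators, hence has energy \<open>0\<close>, and vanishes. If it does not, then \<open>D vac\<close> is a finite sum,
  minus a supertrace times \<open>dim V\<close>, which gives the central charge.
\<close>

lemma clinearI:
  assumes "\<And>x y. f (x + y) = f x + f y" "\<And>c x. f (c *\<^sub>C x) = c *\<^sub>C f x"
  shows "clinear f"
  using assms by unfold_locales

section \<open>Quadratic operators on Fock modules\<close>

text \<open>The Koszul sign, with \<open>True\<close> standing for odd.\<close>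

definition sg :: "bool \<Rightarrow> bool \<Rightarrow> complex"
  where "sg s t = (if s \<and> t then - 1 else 1)"

lemma sg_simps [simp]: "sg False t = 1" "sg s False = 1" "sg True True = - 1"
  by (simp_all add: sg_def)

lemma sum_bool: "(\<Sum>s\<in>UNIV. f s) = f False + f True"
  by (simp add: UNIV_bool)

lemma sg_commute: "sg s t = sg t s"
  by (simp add: sg_def)

lemma sg_sq [simp]: "sg s t * sg s t = 1" "sg s t * (sg s t * c) = c"
  by (simp_all add: sg_def)

text \<open>The boolean is the parity: \<open>X False\<close> and \<open>Y False\<close> are bosonic, \<open>X True\<close> and \<open>Y True\<close> fermionic.
  \<open>X s i n\<close> and \<open>Y s i n\<close> stand for \<open>v\<^sub>i t\<^sup>n\<close> and the dual functional.\<close>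

locale fock_module =
  fixes I :: "'i set"
    and X Y :: "bool \<Rightarrow> 'i \<Rightarrow> int \<Rightarrow> 'w::complex_vector \<Rightarrow> 'w"
    and vac :: 'w
  assumes finite_I: "finite I"
    and clinear_X: "clinear (X s i n)"
    and clinear_Y: "clinear (Y s i n)"
    and X_X: "X s i m (X t j n w) = sg s t *\<^sub>C X t j n (X s i m w)"
    and Y_Y: "Y s i m (Y t j n w) = sg s t *\<^sub>C Y t j n (Y s i m w)"
    and Y_X: "i \<in> I \<Longrightarrow> j \<in> I \<Longrightarrow>
      Y s i m (X t j n w) = sg s t *\<^sub>C X t j n (Y s i m w) + (if s = t \<and> i = j \<and> m = n then w else 0)"
    and X_vac: "0 < n \<Longrightarrow> X s i n vac = 0"
    and Y_vac: "n \<le> 0 \<Longrightarrow> Y s i n vac = 0"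
    and cyclic: "csubspace S \<Longrightarrow> vac \<in> S \<Longrightarrow>
      (\<And>s i n w. i \<in> I \<Longrightarrow> w \<in> S \<Longrightarrow> X s i n w \<in> S) \<Longrightarrow>
      (\<And>s i n w. i \<in> I \<Longrightarrow> w \<in> S \<Longrightarrow> Y s i n w \<in> S) \<Longrightarrow> w \<in> S"
begin

lemmas X_lin [simp] =
  complex_vector.linear_add[OF clinear_X] complex_vector.linear_scale[OF clinear_X]
  complex_vector.linear_0[OF clinear_X] complex_vector.linear_diff[OF clinear_X]
  complex_vector.linear_neg[OF clinear_X] complex_vector.linear_sum[OF clinear_X]

lemmas Y_lin [simp] =
  complex_vector.linear_add[OF clinear_Y] complex_vector.linear_scale[OF clinear_Y]
  complex_vector.linear_0[OF clinear_Y] complex_vector.linear_diff[OF clinear_Y]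
  complex_vector.linear_neg[OF clinear_Y] complex_vector.linear_sum[OF clinear_Y]

section \<open>Normally ordered products and their exchange with modes\<close>

lemma X_Y: "i \<in> I \<Longrightarrow> j \<in> I \<Longrightarrow>
  X s i m (Y t j n w) = sg s t *\<^sub>C (Y t j n (X s i m w) - (if s = t \<and> i = j \<and> m = n then w else 0))"
  by (auto simp: Y_X sg_commute[of t s])

text \<open>\<open>Y\<close> of index \<open>p\<close> is an annihilator for \<open>p <= 0\<close>
  and a creator for \<open>p > 0\<close>, so the order can be decided by \<open>p\<close> alone: an
  annihilating \<open>Y\<close> goes to the right, a creating one to the left.\<close>

definition normal_ord :: "bool \<Rightarrow> bool \<Rightarrow> 'i \<Rightarrow> int \<Rightarrow> int \<Rightarrow> 'w \<Rightarrow> 'w"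
  where "normal_ord s t i q p w =
    (if p \<le> 0 then X s i q (Y t i p w) else sg s t *\<^sub>C Y t i p (X s i q w))"

text \<open>Normal ordering changes the product by a multiple of the identity only, and only when
  \<open>s = t\<close>, where \<open>sg s u * sg t u = 1\<close>. Hence \<open>normal_ord_X\<close>
  and \<open>normal_ord_Y\<close> can be computed from the plain product.\<close>

lemma normal_ord_eq:
  assumes "i \<in> I"
  shows "normal_ord s t i q p w =
    X s i q (Y t i p w) + (if 0 < p \<and> s = t \<and> p = q then sg s s *\<^sub>C w else 0)"
  using assms
  by (auto simp: normal_ord_def Y_X sg_commute[of t s] scaleC_one scaleC_add_right)

lemma clinear_normal_ord: "clinear (normal_ord s t i q p)"
  by unfold_locales
    (simp_all add: normal_ord_def scaleC_add_right mult.commute)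

lemma normal_ord_X:
  assumes "i \<in> I" "j \<in> I"
  shows "normal_ord s t i q p (X u j m w) =
    (sg s u * sg t u) *\<^sub>C X u j m (normal_ord s t i q p w) + (if t = u \<and> i = j \<and> p = m then X s i q w else 0)"
proof -
  have "X s i q (Y t i p (X u j m w)) =
      (sg s u * sg t u) *\<^sub>C X u j m (X s i q (Y t i p w)) + (if t = u \<and> i = j \<and> p = m then X s i q w else 0)"
    using assms by (simp add: Y_X X_X[of s i q u] mult_ac)
  then show ?thesis
    using assms by (auto simp: normal_ord_eq scaleC_add_right)
qed

lemma normal_ord_Y:
  assumes "i \<in> I" "j \<in> I"
  shows "normal_ord s t i q p (Y u j m w) =
    (sg s u * sg t u) *\<^sub>C Y u j m (normal_ord s t i q p w)
    - (if s = u \<and> i = j \<and> q = m then (sg s u * sg t u) *\<^sub>C Y t i p w else 0)"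
proof -
  have "X s i q (Y t i p (Y u j m w)) = (sg s u * sg t u) *\<^sub>C Y u j m (X s i q (Y t i p w))
      - (if s = u \<and> i = j \<and> q = m then (sg s u * sg t u) *\<^sub>C Y t i p w else 0)"
    using assms
    by (auto simp: X_Y Y_Y[of t i p u] mult_ac sg_commute[of t]
        complex_vector.scale_right_diff_distrib)
  then show ?thesis
    using assms by (auto simp: normal_ord_eq scaleC_add_right)
qed

section \<open>Local finiteness and finite sets of summation\<close>

lemma locally_finite: "\<exists>N\<ge>0. \<forall>n>N. \<forall>s. \<forall>i\<in>I. X s i n w = 0 \<and> Y s i (- n) w = 0"
proof -
  define S where "S = {w. \<exists>N\<ge>0. \<forall>n>N. \<forall>s. \<forall>i\<in>I. X s i n w = 0 \<and> Y s i (- n) w = 0}"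
  have "w \<in> S"
  proof (rule cyclic)
    show "csubspace S"
    proof (rule complex_vector.subspaceI)
      fix x y assume "x \<in> S" "y \<in> S"
      then obtain M N where "0 \<le> M" "\<forall>n>M. \<forall>s. \<forall>i\<in>I. X s i n x = 0 \<and> Y s i (- n) x = 0"
        "0 \<le> N" "\<forall>n>N. \<forall>s. \<forall>i\<in>I. X s i n y = 0 \<and> Y s i (- n) y = 0"
        unfolding S_def by blast
      then show "x + y \<in> S"
        unfolding S_def by (intro CollectI exI[of _ "max M N"]) auto
    qed (auto simp: S_def)
    show "vac \<in> S"
      unfolding S_def by (intro CollectI exI[of _ 0]) (auto intro: X_vac Y_vac)
  next
    fix s i m w assume i: "i \<in> I" and "w \<in> S"
    then obtain N where N: "0 \<le> N" "\<forall>n>N. \<forall>s. \<forall>i\<in>I. X s i n w = 0 \<and> Y s i (- n) w = 0"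
      unfolding S_def by blast
    \<comment> \<open>Moving \<open>Y\<close> of index \<open>- n\<close> past
      \<open>X s i m\<close> leaves a contraction only if \<open>n = - m\<close>; taking
      \<open>n > - m\<close> excludes it. For \<open>Y s i m\<close> below, the contraction sits at
      \<open>n = m\<close>.\<close>
    show "X s i m w \<in> S"
      unfolding S_def
      by (intro CollectI exI[of _ "max N (- m)"]) (use N i in \<open>auto simp: X_X[of _ _ _ s i m] Y_X\<close>)
    show "Y s i m w \<in> S"
      unfolding S_def
      by (intro CollectI exI[of _ "max N m"]) (use N i in \<open>auto simp: Y_Y[of _ _ _ s i m] X_Y\<close>)
  qed
  then show ?thesis
    by (simp add: S_def)
qed

text \<open>Any such \<open>J\<close> may serve as the range of summation in \<open>quad\<close>,
  which lets several vectors share one finite sum.\<close>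

definition bounds :: "int \<Rightarrow> 'w \<Rightarrow> int set \<Rightarrow> bool"
  where "bounds k w J \<longleftrightarrow>
    finite J \<and> (\<forall>p. p \<notin> J \<longrightarrow> (\<forall>s t. \<forall>i\<in>I. normal_ord s t i (p + k) p w = 0))"

lemma bounds_superset: "bounds k w J \<Longrightarrow> J \<subseteq> K \<Longrightarrow> finite K \<Longrightarrow> bounds k w K"
  unfolding bounds_def by blast

text \<open>Below \<open>- N\<close> the right factor \<open>Y\<close> kills \<open>w\<close>; above
  \<open>N + \<bar>k\<bar>\<close> one has \<open>p + k > N\<close>, and the right factor
  \<open>X\<close> does.\<close>

lemma bounds_exists: "\<exists>J. bounds k w J"
proof -
  obtain N where N: "0 \<le> N" "\<forall>n>N. \<forall>s. \<forall>i\<in>I. X s i n w = 0 \<and> Y s i (- n) w = 0"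
    using locally_finite by blast
  have "normal_ord s t i (p + k) p w = 0" if p: "p \<notin> {- N..N + \<bar>k\<bar>}" and i: "i \<in> I" for s t i p
  proof (cases "p \<le> 0")
    case True
    then have "N < - p" using p N(1) by auto
    then have "Y t i p w = 0" using N(2) i by (metis minus_minus)
    then show ?thesis using True by (simp add: normal_ord_def)
  next
    case False
    then have "N < p + k" using p N(1) by auto
    then show ?thesis using N(2) i False by (simp add: normal_ord_def)
  qed
  then have "bounds k w {- N..N + \<bar>k\<bar>}"
    by (simp add: bounds_def)
  then show ?thesis ..
qed

lemma bounds_common:
  assumes "finite Ws"
  obtains J where "m \<in> J" "finite J" "\<And>w. w \<in> Ws \<Longrightarrow> bounds k w J"
proof -
  obtain J where J: "bounds k w (J w)" for w
    using bounds_exists by metis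
  have fin: "finite (insert m (\<Union>w\<in>Ws. J w))"
    using assms J by (auto simp: bounds_def)
  then have "bounds k w (insert m (\<Union>w\<in>Ws. J w))" if "w \<in> Ws" for w
    using that by (intro bounds_superset[OF J[of w]]) auto
  then show ?thesis
    by (rule that[OF insertI1 fin])
qed

text \<open>\<open>A\<close> and the shift \<open>k\<close> encode the band matrix with entry \<open>A s t p\<close> in row \<open>(s, p + k)\<close> and column
  \<open>(t, p)\<close>.\<close>

definition quad :: "(bool \<Rightarrow> bool \<Rightarrow> int \<Rightarrow> complex) \<Rightarrow> int \<Rightarrow> 'w \<Rightarrow> 'w"
  where "quad A k w =
    (\<Sum>i\<in>I. Sum_any (\<lambda>p. \<Sum>s\<in>UNIV. \<Sum>t\<in>UNIV. A s t p *\<^sub>C normal_ord s t i (p + k) p w))"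

text \<open>\<open>Sum_any\<close> falls back to 0 on infinite support; \<open>bounds\<close>
  ensures that the support is finite.\<close>

lemma quad_eq:
  assumes "bounds k w J"
  shows "quad A k w =
    (\<Sum>i\<in>I. \<Sum>p\<in>J. \<Sum>s\<in>UNIV. \<Sum>t\<in>UNIV. A s t p *\<^sub>C normal_ord s t i (p + k) p w)"
  unfolding quad_def
proof (rule sum.cong[OF refl], rule Sum_any.expand_superset)
  show "finite J" using assms by (simp add: bounds_def)
  show "{p. (\<Sum>s\<in>UNIV. \<Sum>t\<in>UNIV. A s t p *\<^sub>C normal_ord s t i (p + k) p w) \<noteq> 0} \<subseteq> J" if "i \<in> I" for i
  proof (rule subsetI, rule ccontr)
    fix p assume "p \<in> {p. (\<Sum>s\<in>UNIV. \<Sum>t\<in>UNIV. A s t p *\<^sub>C normal_ord s t i (p + k) p w) \<noteq> 0}" "p \<notin> J"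
    then show False
      using assms that by (simp add: bounds_def)
  qed
qed

lemma clinear_quad: "clinear (quad A k)"
proof unfold_locales
  fix x y c
  obtain J where J: "bounds k w J" if "w \<in> {x, y, x + y, c *\<^sub>C x}" for w
    by (rule bounds_common[of "{x, y, x + y, c *\<^sub>C x}"]) auto
  note eq = J[THEN quad_eq]
  note lin = complex_vector.linear_add[OF clinear_normal_ord] complex_vector.linear_scale[OF clinear_normal_ord]
  show "quad A k (x + y) = quad A k x + quad A k y"
    by (simp add: eq lin scaleC_add_right sum.distrib)
  show "quad A k (c *\<^sub>C x) = c *\<^sub>C quad A k x"
    by (simp add: eq lin mult.commute complex_vector.scale_sum_right)
qed

lemmas quad_lin [simp] =
  complex_vector.linear_add[OF clinear_quad] complex_vector.linear_scale[OF clinear_quad]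
  complex_vector.linear_0[OF clinear_quad] complex_vector.linear_diff[OF clinear_quad]
  complex_vector.linear_neg[OF clinear_quad] complex_vector.linear_sum[OF clinear_quad]

lemma quad_add: "quad (\<lambda>s t p. A s t p + B s t p) k w = quad A k w + quad B k w"
proof -
  obtain J where J: "bounds k w J" using bounds_exists by blast
  show ?thesis by (simp add: quad_eq[OF J] scaleC_add_left sum.distrib)
qed

lemma quad_scale: "quad (\<lambda>s t p. c * A s t p) k w = c *\<^sub>C quad A k w"
proof -
  obtain J where J: "bounds k w J" using bounds_exists by blast
  show ?thesis by (simp add: quad_eq[OF J] complex_vector.scale_sum_right)
qed

end

section \<open>Supercommutators of quadratic operators with single modes\<close>

definition has_parity :: "bool \<Rightarrow> (bool \<Rightarrow> bool \<Rightarrow> int \<Rightarrow> complex) \<Rightarrow> bool"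
  where "has_parity e A \<longleftrightarrow> (\<forall>s t p. (s \<noteq> t) \<noteq> e \<longrightarrow> A s t p = 0)"

text \<open>On the support of \<open>A\<close>, the sign for moving a mode past both factors depends
  on \<open>e\<close> alone. All terms of \<open>quad A k\<close> thus share one sign, which can be
  pulled out of the sum.\<close>

lemma has_parity_sg:
  assumes "has_parity e A" "A s t p \<noteq> 0"
  shows "sg s u * sg t u = sg e u"
proof -
  have "e = (s \<noteq> t)"
    using assms by (auto simp: has_parity_def)
  then show ?thesis
    by (cases s; cases t; cases u) simp_all
qed

context fock_module
begin

text \<open>The correction term is column \<open>(u, m)\<close> of the band matrix: the
  supercommutator with \<open>quad A k\<close> acts on the \<open>X\<close> modes as the matrix
  itself.\<close>

lemma quad_X:
  assumes A: "has_parity e A" and j: "j \<in> I"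
  shows "quad A k (X u j m w) =
    sg e u *\<^sub>C X u j m (quad A k w) + (\<Sum>s\<in>UNIV. A s u m *\<^sub>C X s j (m + k) w)"
proof -
  \<comment> \<open>The contraction sits at \<open>p = m\<close>; putting \<open>m\<close> into
    \<open>J\<close> keeps it inside the sum.\<close>
  obtain J where m: "m \<in> J" and fin: "finite J" and J: "\<And>w'. w' \<in> {w, X u j m w} \<Longrightarrow> bounds k w' J"
    by (rule bounds_common[of "{w, X u j m w}" m k]) auto
  \<comment> \<open>The nested conditionals let the sums over \<open>t\<close>, \<open>p\<close> and
    \<open>i\<close> collapse one after the other.\<close>
  have term_eq: "A s t p *\<^sub>C normal_ord s t i (p + k) p (X u j m w) =
      sg e u *\<^sub>C X u j m (A s t p *\<^sub>C normal_ord s t i (p + k) p w)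
      + (if i = j then if p = m then if t = u then A s u m *\<^sub>C X s j (m + k) w else 0 else 0 else 0)"
    if "i \<in> I" for s t i p
    using A that j
    by (cases "A s t p = 0")
      (auto simp: normal_ord_X scaleC_add_right mult.commute
        complex_vector.scale_right_diff_distrib has_parity_sg[OF A] simp del: sg_simps)
  have "quad A k (X u j m w) = (\<Sum>i\<in>I. \<Sum>p\<in>J. \<Sum>s\<in>UNIV. \<Sum>t\<in>UNIV.
      sg e u *\<^sub>C X u j m (A s t p *\<^sub>C normal_ord s t i (p + k) p w)
      + (if i = j then if p = m then if t = u then A s u m *\<^sub>C X s j (m + k) w else 0 else 0 else 0))"
    unfolding quad_eq[OF J, of "X u j m w", simplified] by (intro sum.cong refl term_eq)
  also have "\<dots> = sg e u *\<^sub>C X u j m (quad A k w) + (\<Sum>i\<in>I. \<Sum>p\<in>J. \<Sum>s\<in>UNIV. \<Sum>t\<in>UNIV.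
      (if i = j then if p = m then if t = u then A s u m *\<^sub>C X s j (m + k) w else 0 else 0 else 0))"
    by (simp only: sum.distrib quad_eq[OF J, of w] insert_iff simp_thms X_lin
        complex_vector.scale_sum_right)
  also have "(\<Sum>i\<in>I. \<Sum>p\<in>J. \<Sum>s\<in>UNIV. \<Sum>t\<in>UNIV.
      (if i = j then if p = m then if t = u then A s u m *\<^sub>C X s j (m + k) w else 0 else 0 else 0))
      = (\<Sum>s\<in>UNIV. A s u m *\<^sub>C X s j (m + k) w)"
  proof -
    have inner: "(\<Sum>s\<in>UNIV. \<Sum>t\<in>UNIV. (if i = j then if p = m then if t = u then A s u m *\<^sub>C X s j (m + k) w else 0 else 0 else 0))
        = (if i = j then if p = m then (\<Sum>s\<in>UNIV. A s u m *\<^sub>C X s j (m + k) w) else 0 else 0)" for i p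
      by (cases u) (simp_all add: sum_bool)
    have "(\<Sum>p\<in>J. \<Sum>s\<in>UNIV. \<Sum>t\<in>UNIV. (if i = j then if p = m then if t = u then A s u m *\<^sub>C X s j (m + k) w else 0 else 0 else 0))
        = (if i = j then (\<Sum>s\<in>UNIV. A s u m *\<^sub>C X s j (m + k) w) else 0)" for i
      unfolding inner using fin m by simp
    then show ?thesis
      using j finite_I by simp
  qed
  finally show ?thesis .
qed

text \<open>Dually, the \<open>Y\<close> modes transform by the negative transpose, up to the sign
  \<open>sg e u\<close>: the correction is row \<open>(u, m)\<close>, whose entries lie in the
  columns of index \<open>m - k\<close>.\<close>

lemma quad_Y:
  assumes A: "has_parity e A" and j: "j \<in> I"
  shows "quad A k (Y u j m w) =
    sg e u *\<^sub>C Y u j m (quad A k w) - sg e u *\<^sub>C (\<Sum>t\<in>UNIV. A u t (m - k) *\<^sub>C Y t j (m - k) w)"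
proof -
  obtain J where m: "m - k \<in> J" and fin: "finite J" and J: "\<And>w'. w' \<in> {w, Y u j m w} \<Longrightarrow> bounds k w' J"
    by (rule bounds_common[of "{w, Y u j m w}" "m - k" k]) auto
  have term_eq: "A s t p *\<^sub>C normal_ord s t i (p + k) p (Y u j m w) =
      sg e u *\<^sub>C Y u j m (A s t p *\<^sub>C normal_ord s t i (p + k) p w)
      - sg e u *\<^sub>C (if i = j then if p = m - k then if s = u then A u t (m - k) *\<^sub>C Y t j (m - k) w else 0 else 0 else 0)"
    if "i \<in> I" for s t i p
    using A that j
    by (cases "A s t p = 0")
      (auto simp: normal_ord_Y scaleC_add_right mult.commute
        complex_vector.scale_right_diff_distrib has_parity_sg[OF A] simp del: sg_simps)
  have "quad A k (Y u j m w) = (\<Sum>i\<in>I. \<Sum>p\<in>J. \<Sum>s\<in>UNIV. \<Sum>t\<in>UNIV.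
      sg e u *\<^sub>C Y u j m (A s t p *\<^sub>C normal_ord s t i (p + k) p w)
      - sg e u *\<^sub>C (if i = j then if p = m - k then if s = u then A u t (m - k) *\<^sub>C Y t j (m - k) w else 0 else 0 else 0))"
    unfolding quad_eq[OF J, of "Y u j m w", simplified] by (intro sum.cong refl term_eq)
  also have "\<dots> = sg e u *\<^sub>C Y u j m (quad A k w) - sg e u *\<^sub>C (\<Sum>i\<in>I. \<Sum>p\<in>J. \<Sum>s\<in>UNIV. \<Sum>t\<in>UNIV.
      (if i = j then if p = m - k then if s = u then A u t (m - k) *\<^sub>C Y t j (m - k) w else 0 else 0 else 0))"
    by (simp only: sum_subtractf quad_eq[OF J, of w] insert_iff simp_thms Y_lin
        complex_vector.scale_sum_right)
  also have "(\<Sum>i\<in>I. \<Sum>p\<in>J. \<Sum>s\<in>UNIV. \<Sum>t\<in>UNIV.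
      (if i = j then if p = m - k then if s = u then A u t (m - k) *\<^sub>C Y t j (m - k) w else 0 else 0 else 0))
      = (\<Sum>t\<in>UNIV. A u t (m - k) *\<^sub>C Y t j (m - k) w)"
  proof -
    have inner: "(\<Sum>s\<in>UNIV. \<Sum>t\<in>UNIV. (if i = j then if p = m - k then if s = u then A u t (m - k) *\<^sub>C Y t j (m - k) w else 0 else 0 else 0))
        = (if i = j then if p = m - k then (\<Sum>t\<in>UNIV. A u t (m - k) *\<^sub>C Y t j (m - k) w) else 0 else 0)" for i p
      by (cases u) (simp_all add: sum_bool)
    have "(\<Sum>p\<in>J. \<Sum>s\<in>UNIV. \<Sum>t\<in>UNIV. (if i = j then if p = m - k then if s = u then A u t (m - k) *\<^sub>C Y t j (m - k) w else 0 else 0 else 0))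
        = (if i = j then (\<Sum>t\<in>UNIV. A u t (m - k) *\<^sub>C Y t j (m - k) w) else 0)" for i
      unfolding inner using fin m by simp
    then show ?thesis
      using j finite_I by simp
  qed
  finally show ?thesis .
qed

end

section \<open>The commutator of quadratic operators\<close>

text \<open>The super bracket of two matrices, encoded as in \<open>quad\<close>, of parities \<open>e\<close> and \<open>e'\<close>.\<close>

definition mat_bracket ::
    "(bool \<Rightarrow> bool \<Rightarrow> int \<Rightarrow> complex) \<Rightarrow> bool \<Rightarrow> int \<Rightarrow> (bool \<Rightarrow> bool \<Rightarrow> int \<Rightarrow> complex) \<Rightarrow> bool \<Rightarrow> int
      \<Rightarrow> bool \<Rightarrow> bool \<Rightarrow> int \<Rightarrow> complex"
  where "mat_bracket A e k B e' l s t p =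
    (\<Sum>u\<in>UNIV. A s u (p + l) * B u t p) - sg e e' * (\<Sum>u\<in>UNIV. B s u (p + k) * A u t p)"

lemma has_parity_mat_bracket:
  assumes "has_parity e A" "has_parity e' B"
  shows "has_parity (e \<noteq> e') (mat_bracket A e k B e' l)"
proof -
  have "mat_bracket A e k B e' l s t p = 0" if st: "(s \<noteq> t) \<noteq> (e \<noteq> e')" for s t p
  proof -
    have zero: "A s u (p + l) * B u t p = 0" "B s u (p + k) * A u t p = 0" for u
      using assms st unfolding has_parity_def mult_eq_0_iff by metis+
    show ?thesis
      unfolding mat_bracket_def zero by simp
  qed
  then show ?thesis
    by (simp add: has_parity_def)
qed

section \<open>Energy, and the failure of the bracket relation on the cyclic vector\<close>

context fock_module
begin

text \<open>The kernel of \<open>D\<close> is a subspace that contains the cyclic vector and is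
  stable under all modes.\<close>

lemma zero_if_supercommutes:
  assumes "clinear D" "D vac = 0"
    and X: "\<And>s i n w. i \<in> I \<Longrightarrow> D (X s i n w) = sg e s *\<^sub>C X s i n (D w)"
    and Y: "\<And>s i n w. i \<in> I \<Longrightarrow> D (Y s i n w) = sg e s *\<^sub>C Y s i n (D w)"
  shows "D w = 0"
proof -
  have "w \<in> {w. D w = 0}"
  proof (rule cyclic)
    show "csubspace {w. D w = 0}"
      by (rule complex_vector.subspaceI)
        (simp_all add: complex_vector.linear_add[OF assms(1)] complex_vector.linear_scale[OF assms(1)]
          complex_vector.linear_0[OF assms(1)])
  qed (use assms in auto)
  then show ?thesis by simp
qed

text \<open>If \<open>p <= 0\<close>, then \<open>Y\<close> kills \<open>vac\<close>; otherwise
  \<open>q >= p > 0\<close>, and \<open>X\<close> does.\<close>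

lemma normal_ord_vac: "i \<in> I \<Longrightarrow> 0 \<le> q - p \<Longrightarrow> normal_ord s t i q p vac = 0"
  by (simp add: normal_ord_def X_vac Y_vac)

lemma quad_vac:
  assumes "0 \<le> k"
  shows "quad A k vac = 0"
proof -
  have "bounds k vac {}"
    using assms by (simp add: bounds_def normal_ord_vac)
  then show ?thesis
    by (simp add: quad_eq)
qed

text \<open>The quadratic operator of t d/dt. It is a degree operator: \<open>X\<close> of index
  \<open>m\<close> has degree \<open>m\<close>, \<open>Y\<close> of index \<open>m\<close> has
  degree \<open>- m\<close>, and \<open>quad A k\<close> has degree \<open>k\<close>.\<close>

definition energy :: "'w \<Rightarrow> 'w"
  where "energy = quad (\<lambda>s t p. if s = t then of_int p else 0) 0"

lemma has_parity_energy: "has_parity False (\<lambda>s t p. if s = t then of_int p else 0)"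
  by (simp add: has_parity_def)

lemma clinear_energy: "clinear energy"
  unfolding energy_def by (rule clinear_quad)

lemma energy_X: "j \<in> I \<Longrightarrow> energy (X u j m w) = X u j m (energy w) + of_int m *\<^sub>C X u j m w"
  unfolding energy_def by (cases u) (simp_all add: quad_X[OF has_parity_energy] sum_bool)

lemma energy_Y: "j \<in> I \<Longrightarrow> energy (Y u j m w) = Y u j m (energy w) - of_int m *\<^sub>C Y u j m w"
  unfolding energy_def by (cases u) (simp_all add: quad_Y[OF has_parity_energy] sum_bool)

lemma energy_normal_ord:
  assumes "i \<in> I"
  shows "energy (normal_ord s t i q p w) = normal_ord s t i q p (energy w) + of_int (q - p) *\<^sub>C normal_ord s t i q p w"
  using assms complex_vector.linear_scale[OF clinear_energy]
  by (simp add: normal_ord_def energy_X energy_Y algebra_simps scaleC_add_right scaleC_add_left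
      complex_vector.scale_right_diff_distrib complex_vector.scale_left_diff_distrib)

lemma energy_quad: "energy (quad A k w) = quad A k (energy w) + of_int k *\<^sub>C quad A k w"
proof -
  obtain J where J: "\<And>w'. w' \<in> {w, energy w} \<Longrightarrow> bounds k w' J"
    by (rule bounds_common[of "{w, energy w}"]) auto
  note eq = J[THEN quad_eq]
  note lin = complex_vector.linear_sum[OF clinear_energy] complex_vector.linear_scale[OF clinear_energy]
  show ?thesis
    by (simp add: eq lin energy_normal_ord scaleC_add_right sum.distrib
        complex_vector.scale_sum_right mult.commute)
qed

text \<open>In shift 0 both factors of a normally ordered product have the same index
  \<open>p\<close>, and the right one is an annihilator: \<open>Y\<close> for \<open>p <= 0\<close>,
  \<open>X\<close> for \<open>p > 0\<close>.\<close>

lemma energy_eq_0_if_annihilated: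
  assumes "\<And>s i n. i \<in> I \<Longrightarrow> 0 < n \<Longrightarrow> X s i n w = 0" "\<And>s i n. i \<in> I \<Longrightarrow> n \<le> 0 \<Longrightarrow> Y s i n w = 0"
  shows "energy w = 0"
proof -
  have "bounds 0 w {}"
    using assms by (simp add: bounds_def normal_ord_def)
  then show ?thesis
    by (simp add: energy_def quad_eq)
qed

lemma energy_vac: "energy vac = 0"
  by (simp add: energy_def quad_vac)

text \<open>Measures how far \<open>quad\<close> is from preserving super brackets; the aim is to
  show that it is a scalar.\<close>

definition defect ::
    "(bool \<Rightarrow> bool \<Rightarrow> int \<Rightarrow> complex) \<Rightarrow> bool \<Rightarrow> int \<Rightarrow> (bool \<Rightarrow> bool \<Rightarrow> int \<Rightarrow> complex) \<Rightarrow> bool \<Rightarrow> int \<Rightarrow> 'w \<Rightarrow> 'w"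
  where "defect A e k B e' l w =
    quad A k (quad B l w) - sg e e' *\<^sub>C quad B l (quad A k w)
    - quad (mat_bracket A e k B e' l) (k + l) w"

lemma clinear_defect: "clinear (defect A e k B e' l)"
  by unfold_locales
    (simp_all add: defect_def algebra_simps scaleC_add_right complex_vector.scale_right_diff_distrib mult.commute)

text \<open>A form of the super Jacobi identity: by \<open>quad_X\<close> the supercommutator and
  the quadratic operator of \<open>mat_bracket\<close> act on the \<open>X\<close> modes by the same
  matrix, so the correction terms cancel and only the sign of the total parity is left.\<close>

lemma defect_X:
  assumes A: "has_parity e A" and B: "has_parity e' B" and "j \<in> I"
  shows "defect A e k B e' l (X u j m w) = sg (e \<noteq> e') u *\<^sub>C X u j m (defect A e k B e' l w)"
  using \<open>j \<in> I\<close> A B has_parity_mat_bracket[OF A B, of k l]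
    A[unfolded has_parity_def all_bool_eq] B[unfolded has_parity_def all_bool_eq]
  by (cases e; cases e'; cases u)
    (simp_all add: defect_def quad_X
      sum_bool mat_bracket_def algebra_simps scaleC_add_right scaleC_add_left
      complex_vector.scale_right_diff_distrib complex_vector.scale_left_diff_distrib)

lemma defect_Y:
  assumes A: "has_parity e A" and B: "has_parity e' B" and "j \<in> I"
  shows "defect A e k B e' l (Y u j m w) = sg (e \<noteq> e') u *\<^sub>C Y u j m (defect A e k B e' l w)"
  using \<open>j \<in> I\<close> A B has_parity_mat_bracket[OF A B, of k l]
    A[unfolded has_parity_def all_bool_eq] B[unfolded has_parity_def all_bool_eq]
  by (cases e; cases e'; cases u)
    (simp_all add: defect_def quad_Y
      sum_bool mat_bracket_def algebra_simps scaleC_add_right scaleC_add_left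
      complex_vector.scale_right_diff_distrib complex_vector.scale_left_diff_distrib)

text \<open>The vector has energy \<open>k + l\<close> by \<open>energy_quad\<close>; being killed
  by all annihilators, it also has energy 0.\<close>

lemma defect_vac_if_shift_nonzero:
  assumes A: "has_parity e A" and B: "has_parity e' B" and kl: "k + l \<noteq> 0"
  shows "defect A e k B e' l vac = 0"
proof -
  let ?D = "defect A e k B e' l"
  note D0 = complex_vector.linear_0[OF clinear_defect]
  have "X s i n (?D vac) = 0" if "i \<in> I" "0 < n" for s i n
  proof -
    have "sg (e \<noteq> e') s *\<^sub>C X s i n (?D vac) = 0"
      using defect_X[OF A B that(1), of k l s n vac] that(2) by (simp add: X_vac D0)
    then show ?thesis
      by (auto simp: sg_def split: if_splits)
  qed
  moreover have "Y s i n (?D vac) = 0" if "i \<in> I" "n \<le> 0" for s i n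
  proof -
    have "sg (e \<noteq> e') s *\<^sub>C Y s i n (?D vac) = 0"
      using defect_Y[OF A B that(1), of k l s n vac] that(2) by (simp add: Y_vac D0)
    then show ?thesis
      by (auto simp: sg_def split: if_splits)
  qed
  ultimately have "energy (?D vac) = 0"
    by (rule energy_eq_0_if_annihilated)
  moreover have "energy (?D vac) = of_int (k + l) *\<^sub>C ?D vac"
    by (simp add: defect_def complex_vector.linear_diff[OF clinear_energy] complex_vector.linear_add[OF clinear_energy]
        complex_vector.linear_scale[OF clinear_energy]
        energy_quad energy_vac scaleC_add_left scaleC_add_right complex_vector.scale_right_diff_distrib
        mult.commute algebra_simps)
  ultimately have "of_int (k + l) *\<^sub>C ?D vac = 0"
    by simp
  then show ?thesis
    using kl by (simp del: of_int_add)
qed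

text \<open>Only the modes \<open>1 \<le> p \<le> k\<close> contribute to \<open>quad A k (quad B (- k) vac)\<close>, and the sum over them is
  minus the supertrace.\<close>

definition cocycle ::
    "(bool \<Rightarrow> bool \<Rightarrow> int \<Rightarrow> complex) \<Rightarrow> int \<Rightarrow> (bool \<Rightarrow> bool \<Rightarrow> int \<Rightarrow> complex) \<Rightarrow> complex"
  where "cocycle A k B =
    - of_nat (card I) * (\<Sum>p\<in>{1..k}. \<Sum>s\<in>UNIV. \<Sum>t\<in>UNIV. sg t t * A t s (p - k) * B s t p)"

text \<open>For \<open>1 <= p <= k\<close>, \<open>quad A k\<close> kills \<open>vac\<close> and
  turns \<open>X\<close> of index \<open>p - k\<close> into annihilators of index \<open>p\<close>.
  What remains comes from turning \<open>Y\<close> of index \<open>p\<close> into \<open>Y\<close>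
  of index \<open>p - k\<close>, which contracts with \<open>X\<close>.\<close>

lemma quad_quad_vac:
  assumes A: "has_parity e A" and k: "0 \<le> k"
  shows "quad A k (quad B (- k) vac) = cocycle A k B *\<^sub>C vac"
proof -
  have zero: "normal_ord s t i (p + - k) p vac = 0" if "i \<in> I" "p \<notin> {1..k}" for s t i p
    using that by (cases "p \<le> 0") (auto simp: normal_ord_def X_vac Y_vac)
  have one: "quad A k (normal_ord s t i (p - k) p vac) = (- sg s t * sg e t * A t s (p - k)) *\<^sub>C vac"
    if i: "i \<in> I" and p: "p \<in> {1..k}" for s t i p
  proof -
    have "quad A k (X s i (p - k) vac) = 0"
      using p i k by (simp add: quad_X[OF A] quad_vac X_vac)
    moreover have "Y u i (p - k) (X s i (p - k) vac) = (if u = s then vac else 0)" for u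
      using p i by (simp add: Y_X Y_vac)
    ultimately have "quad A k (Y t i p (X s i (p - k) vac)) = - (sg e t * A t s (p - k)) *\<^sub>C vac"
      using i by (cases s) (simp_all add: quad_Y[OF A] sum_bool)
    then show ?thesis
      using p by (simp add: normal_ord_def mult_ac)
  qed
  \<comment> \<open>On the support of \<open>A\<close> the parities \<open>s\<close> and
    \<open>t\<close> differ by \<open>e\<close>, so the two exchange signs multiply to the sign of
    the supertrace.\<close>
  have sign: "A t s (p - k) * B s t p * (sg s t * sg e t) = sg t t * A t s (p - k) * B s t p" for s t p
    by (cases "A t s (p - k) = 0")
      (simp_all add: has_parity_sg[OF A, of t s "p - k" t, symmetric] sg_commute[of s t] mult_ac)
  have "bounds (- k) vac {1..k}"
    using zero unfolding bounds_def by (metis finite_atLeastAtMost_int)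
  then have "quad A k (quad B (- k) vac) =
      (\<Sum>i\<in>I. \<Sum>p\<in>{1..k}. \<Sum>s\<in>UNIV. \<Sum>t\<in>UNIV. B s t p *\<^sub>C quad A k (normal_ord s t i (p - k) p vac))"
    by (simp add: quad_eq)
  also have "\<dots> = (\<Sum>i\<in>I. \<Sum>p\<in>{1..k}. \<Sum>s\<in>UNIV. \<Sum>t\<in>UNIV. (- (sg t t * A t s (p - k) * B s t p)) *\<^sub>C vac)"
  proof (intro sum.cong refl)
    fix i s t p assume "i \<in> I" "p \<in> {1..k}"
    then show "B s t p *\<^sub>C quad A k (normal_ord s t i (p - k) p vac)
        = (- (sg t t * A t s (p - k) * B s t p)) *\<^sub>C vac"
      using sign[of t s p] by (simp add: one mult_ac)
  qed
  also have "\<dots> = cocycle A k B *\<^sub>C vac"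
    by (simp add: cocycle_def complex_vector.scale_sum_left[symmetric] sum_negf sum_constant_scale)
  finally show ?thesis .
qed

text \<open>The product of an even and an odd matrix is odd, so its diagonal vanishes.\<close>

lemma cocycle_eq_0:
  assumes A: "has_parity e A" and B: "has_parity e' B" and "e \<noteq> e'"
  shows "cocycle A k B = 0"
proof -
  have zero: "A t s (p - k) * B s t p = 0" for s t p
    using assms unfolding has_parity_def mult_eq_0_iff by metis
  show ?thesis
    unfolding cocycle_def mult.assoc zero by simp
qed

text \<open>For \<open>k + l = 0\<close> the hypothesis makes \<open>quad A k vac\<close> vanish, so
  that a single term of the defect survives on \<open>vac\<close>. Negative \<open>k\<close> is
  reached later through antisymmetry, in \<open>n2_op_bracket\<close>.\<close>

theorem quad_bracket:
  assumes A: "has_parity e A" and B: "has_parity e' B" and kl: "k + l = 0 \<Longrightarrow> 0 \<le> k"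
  shows "quad A k (quad B l w) - sg e e' *\<^sub>C quad B l (quad A k w) =
    quad (mat_bracket A e k B e' l) (k + l) w + (if k + l = 0 then cocycle A k B else 0) *\<^sub>C w"
proof -
  let ?c = "if k + l = 0 then cocycle A k B else 0"
  \<comment> \<open>A scalar commutes with every mode, so subtracting it from an odd defect keeps
    supercommutation only if it is 0.\<close>
  have c: "sg (e \<noteq> e') s * ?c = ?c" for s
    using cocycle_eq_0[OF A B, of k] by (cases "e = e'") auto
  have "defect A e k B e' l w - ?c *\<^sub>C w = 0"
  proof (rule zero_if_supercommutes[where D = "\<lambda>w. defect A e k B e' l w - ?c *\<^sub>C w"])
    show "clinear (\<lambda>w. defect A e k B e' l w - ?c *\<^sub>C w)"
      by (intro complex_vector.linear_compose_sub clinear_defect complex_vector.linear_scale_self)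
    show "defect A e k B e' l vac - ?c *\<^sub>C vac = 0"
    proof (cases "k + l = 0")
      case True
      then have [simp]: "l = - k" "0 \<le> k"
        using kl by auto
      show ?thesis
        using quad_quad_vac[OF A, of k B] by (simp add: defect_def quad_vac)
    next
      case False
      then show ?thesis
        using defect_vac_if_shift_nonzero[OF A B False] by simp
    qed
    show "defect A e k B e' l (X s i n w) - ?c *\<^sub>C X s i n w =
        sg (e \<noteq> e') s *\<^sub>C X s i n (defect A e k B e' l w - ?c *\<^sub>C w)" if "i \<in> I" for s i n w
      unfolding defect_X[OF A B that] X_lin complex_vector.scale_right_diff_distrib
        complex_vector.scale_scale c ..
    show "defect A e k B e' l (Y s i n w) - ?c *\<^sub>C Y s i n w =
        sg (e \<noteq> e') s *\<^sub>C Y s i n (defect A e k B e' l w - ?c *\<^sub>C w)" if "i \<in> I" for s i n w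
      unfolding defect_Y[OF A B that] Y_lin complex_vector.scale_right_diff_distrib
        complex_vector.scale_scale c ..
  qed
  then show ?thesis
    by (simp add: defect_def algebra_simps)
qed

end

section \<open>The \<open>N = 2\<close> superconformal algebra on Fock modules\<close>

lemma sum_of_bool_bit: "of_bool s + of_bool t = (of_bool (s \<noteq> t) :: bit)"
  by (cases s; cases t) simp_all

text \<open>Where this is applied, the summands are first brought to exactly this shape, zero
  coefficients included.\<close>

lemma sum_quadratic:
  assumes "0 \<le> k"
  shows "(\<Sum>p\<in>{1..k}. a + b * of_int p + c * (of_int p)\<^sup>2) =
    a * of_int k + b * (of_int k * (of_int k + 1)) / 2 + c * (of_int k * (of_int k + 1) * (2 * of_int k + 1)) / (6 :: complex)"
  using assms
proof (induction k rule: int_ge_induct)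
  case (step i)
  have "{1..i + 1} = insert (i + 1) {1..i}"
    using step.hyps by auto
  then show ?case
    using step.IH by (simp add: field_simps power2_eq_square)
qed simp

text \<open>Read the bosonic basis vector of index \<open>p\<close> as t^(p-1) dt and the fermionic
  one as t^(p-1) (dt)^(1/2). Then L is the Lie derivative along -t^(n+1) d/dt, H is multiplication
  by t^n on half-densities, G+ is multiplication by t^(k+1) (dt)^(-1/2), and G- is multiplication by
  t^(l+1) (dt)^(-1/2) followed by -2d.\<close>

fun n2_mat :: "n2_gen \<Rightarrow> bool \<Rightarrow> bool \<Rightarrow> int \<Rightarrow> complex"
  where
    "n2_mat (Lgen n) s t p =
      (if s \<noteq> t then 0 else if s then - (of_int p + (of_int n - 1) / 2) else - (of_int n + of_int p))"
  | "n2_mat (Hgen n) s t p = (if s \<and> t then 1 else 0)"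
  | "n2_mat (Gplus k) s t p = (if s \<and> \<not> t then 1 else 0)"
  | "n2_mat (Gminus l) s t p = (if \<not> s \<and> t then - 2 * (of_int p + of_int l) else 0)"
  | "n2_mat Cgen s t p = 0"

text \<open>For G+ and G- of half-integral index r the shifts are r + 1/2 and r - 1/2, so all shifts
  are integers and those of an opposite pair add up to r + s.\<close>

fun n2_shift :: "n2_gen \<Rightarrow> int"
  where
    "n2_shift (Lgen n) = n"
  | "n2_shift (Hgen n) = n"
  | "n2_shift (Gplus k) = k + 1"
  | "n2_shift (Gminus l) = l"
  | "n2_shift Cgen = 0"

definition n2_odd :: "n2_gen \<Rightarrow> bool"
  where "n2_odd a \<longleftrightarrow> n2_gen_parity a = 1"

lemma n2_odd_simps [simp]:
  "\<not> n2_odd (Lgen n)" "\<not> n2_odd (Hgen n)" "n2_odd (Gplus k)" "n2_odd (Gminus k)" "\<not> n2_odd Cgen"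
  by (simp_all add: n2_odd_def)

lemma has_parity_n2_mat: "has_parity (n2_odd a) (n2_mat a)"
  by (cases a) (simp_all add: has_parity_def)

text \<open>Used in \<open>n2_op_bracket\<close> to swap the factors when the first one has negative
  shift.\<close>

lemma n2_gen_bracket_commute:
  "n2_gen_bracket b a = - (sg (n2_odd a) (n2_odd b) *\<^sub>C n2_gen_bracket a b)"
  by (cases a; cases b)
    (auto simp: scaleC_one algebra_simps complex_vector.scale_left_diff_distrib)

section \<open>The operators of the generators and their brackets\<close>

context fock_module
begin

fun n2_op :: "n2_gen \<Rightarrow> 'w \<Rightarrow> 'w"
  where
    "n2_op Cgen w = (3 * of_nat (card I)) *\<^sub>C w"
  | "n2_op a w = quad (n2_mat a) (n2_shift a) w"

lemma n2_op_eq: "a \<noteq> Cgen \<Longrightarrow> n2_op a = quad (n2_mat a) (n2_shift a)"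
  by (cases a) (simp_all add: fun_eq_iff)

lemma clinear_n2_op: "clinear (n2_op a)"
proof (cases "a = Cgen")
  case True
  show ?thesis
    unfolding True by unfold_locales (simp_all add: scaleC_add_right mult.commute)
qed (simp add: n2_op_eq clinear_quad)

definition n2_rep :: "n2 \<Rightarrow> 'w \<Rightarrow> 'w"
  where "n2_rep x w = lin_ext (\<lambda>a. n2_op a w) x"

lemma n2_rep_scale: "n2_rep (c *\<^sub>C x) w = c *\<^sub>C n2_rep x w"
  by (simp add: n2_rep_def lin_ext_scale)

lemma n2_rep_add: "n2_rep (x + y) w = n2_rep x w + n2_rep y w"
  by (simp add: n2_rep_def lin_ext_add)

lemma n2_rep_diff: "n2_rep (x - y) w = n2_rep x w - n2_rep y w"
  by (simp add: n2_rep_def complex_vector.linear_diff[OF clinear_lin_ext])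

lemma n2_rep_minus: "n2_rep (- x) w = - n2_rep x w"
  by (simp add: n2_rep_def complex_vector.linear_neg[OF clinear_lin_ext])

lemma n2_rep_0: "n2_rep 0 w = 0"
  by (simp add: n2_rep_def complex_vector.linear_0[OF clinear_lin_ext])

lemma n2_rep_basis: "n2_rep (n2_basis a) w = n2_op a w"
  by (simp add: n2_rep_def scaleC_one)

lemmas n2_rep_simps = n2_rep_diff n2_rep_scale n2_rep_add n2_rep_minus n2_rep_0 n2_rep_basis

lemma clinear_n2_rep: "clinear (n2_rep x)"
  by unfold_locales
    (simp_all add: n2_rep_def lin_ext_def complex_vector.linear_add[OF clinear_n2_op]
      complex_vector.linear_scale[OF clinear_n2_op] scaleC_add_right sum.distrib
      complex_vector.scale_sum_right mult.commute)

abbreviation n2_mat_bracket :: "n2_gen \<Rightarrow> n2_gen \<Rightarrow> bool \<Rightarrow> bool \<Rightarrow> int \<Rightarrow> complex"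
  where "n2_mat_bracket a b \<equiv>
    mat_bracket (n2_mat a) (n2_odd a) (n2_shift a) (n2_mat b) (n2_odd b) (n2_shift b)"

text \<open>Reduces a bracket to comparisons of matrices, of shifts and of central terms. Two
  targets \<open>d\<close> and \<open>d'\<close> are provided because the bracket of G+ and G- has
  both an L and an H component.\<close>

lemma quad_bracket_eqI:
  assumes "a \<noteq> Cgen" "b \<noteq> Cgen" "n2_shift a + n2_shift b = 0 \<Longrightarrow> 0 \<le> n2_shift a"
    and "n2_mat_bracket a b = (\<lambda>s t p. c * n2_mat d s t p + c' * n2_mat d' s t p)"
    and "d \<noteq> Cgen" "n2_shift d = n2_shift a + n2_shift b"
    and "d' \<noteq> Cgen" "n2_shift d' = n2_shift a + n2_shift b"
    and "\<And>w. n2_rep (n2_gen_bracket a b) w = c *\<^sub>C n2_op d w + c' *\<^sub>C n2_op d' w +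
      (if n2_shift a + n2_shift b = 0 then cocycle (n2_mat a) (n2_shift a) (n2_mat b) else 0) *\<^sub>C w"
  shows "n2_op a (n2_op b w) - sg (n2_odd a) (n2_odd b) *\<^sub>C n2_op b (n2_op a w) =
    n2_rep (n2_gen_bracket a b) w"
  unfolding n2_op_eq[OF assms(1)] n2_op_eq[OF assms(2)]
  using quad_bracket[OF has_parity_n2_mat has_parity_n2_mat assms(3), where w = w]
  by (simp add: assms(4-) n2_op_eq[OF assms(5)] n2_op_eq[OF assms(7)] quad_add quad_scale)

text \<open>In the supertrace the squares of \<open>p\<close> from bosons and fermions cancel,
  leaving a linear summand. The value is \<open>(n^3 - n) / 12\<close> times the central charge
  \<open>3 * card I\<close>.\<close>

lemma cocycle_Lgen:
  assumes m: "m + n = 0" and n: "0 \<le> n"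
  shows "cocycle (n2_mat (Lgen n)) n (n2_mat (Lgen m)) = of_nat (card I) * (of_int n ^ 3 - of_int n) / 4"
proof -
  have m: "m = - n" using m by simp
  have "(\<Sum>s\<in>UNIV. \<Sum>t\<in>UNIV. sg t t * n2_mat (Lgen n) t s (p - n) * n2_mat (Lgen m) s t p) =
    - (of_int n + 1)\<^sup>2 / 4 + 1 * of_int p + 0 * (of_int p)\<^sup>2" for p
    by (simp add: sum_bool m field_simps power2_eq_square)
  then show ?thesis
    unfolding cocycle_def using n
    by (simp only: sum_quadratic) (simp add: field_simps power2_eq_square power3_eq_cube)
qed

lemma cocycle_Hgen:
  "0 \<le> n \<Longrightarrow> cocycle (n2_mat (Hgen n)) n (n2_mat (Hgen m)) = of_nat (card I) * of_int n"
  by (simp add: cocycle_def sum_bool)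

text \<open>The summand is antisymmetric about the midpoint (n + 1)/2 of the range, so the sum
  vanishes; this reflects the weight 1/2 of the fermions. The same holds in
  \<open>cocycle_Hgen_Lgen\<close>.\<close>

lemma cocycle_Lgen_Hgen:
  assumes "0 \<le> n"
  shows "cocycle (n2_mat (Lgen n)) n (n2_mat (Hgen m)) = 0"
proof -
  have "(\<Sum>s\<in>UNIV. \<Sum>t\<in>UNIV. sg t t * n2_mat (Lgen n) t s (p - n) * n2_mat (Hgen m) s t p) =
    - (of_int n + 1) / 2 + 1 * of_int p + 0 * (of_int p)\<^sup>2" for p
    by (simp add: sum_bool field_simps)
  then show ?thesis
    unfolding cocycle_def using assms
    by (simp only: sum_quadratic) (simp add: field_simps)
qed

lemma cocycle_Hgen_Lgen:
  assumes m: "m + n = 0" and n: "0 \<le> n"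
  shows "cocycle (n2_mat (Hgen n)) n (n2_mat (Lgen m)) = 0"
proof -
  have m: "m = - n" using m by simp
  have "(\<Sum>s\<in>UNIV. \<Sum>t\<in>UNIV. sg t t * n2_mat (Hgen n) t s (p - n) * n2_mat (Lgen m) s t p) =
    - (of_int n + 1) / 2 + 1 * of_int p + 0 * (of_int p)\<^sup>2" for p
    by (simp add: sum_bool m field_simps)
  then show ?thesis
    unfolding cocycle_def using n
    by (simp only: sum_quadratic) (simp add: field_simps)
qed

lemma cocycle_Gplus_Gminus:
  assumes l: "1 + (l + k) = 0" and k: "0 \<le> 1 + k"
  shows "cocycle (n2_mat (Gplus k)) (1 + k) (n2_mat (Gminus l)) =
    of_nat (card I) * ((half_int k)\<^sup>2 - 1 / 4)"
proof -
  have l: "l = - (1 + k)" using l by simp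
  have "(\<Sum>s\<in>UNIV. \<Sum>t\<in>UNIV. sg t t * n2_mat (Gplus k) t s (p - (1 + k)) * n2_mat (Gminus l) s t p) =
    - 2 * of_int (1 + k) + 2 * of_int p + 0 * (of_int p)\<^sup>2" for p
    by (simp add: sum_bool l field_simps)
  then show ?thesis
    unfolding cocycle_def using k
    by (simp only: sum_quadratic) (simp add: half_int_def field_simps power2_eq_square)
qed

text \<open>The sum gives l (l + 1), and l = - k - 1 turns this into k (k + 1), the same central
  term as in the other order.\<close>

lemma cocycle_Gminus_Gplus:
  assumes l: "1 + (k + l) = 0" and k: "0 \<le> l"
  shows "cocycle (n2_mat (Gminus l)) l (n2_mat (Gplus k)) =
    of_nat (card I) * ((half_int k)\<^sup>2 - 1 / 4)"
proof -
  have k': "k = - l - 1" using l by simp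
  have "(\<Sum>s\<in>UNIV. \<Sum>t\<in>UNIV. sg t t * n2_mat (Gminus l) t s (p - l) * n2_mat (Gplus k) s t p) =
    0 + - 2 * of_int p + 0 * (of_int p)\<^sup>2" for p
    by (simp add: sum_bool)
  then show ?thesis
    unfolding cocycle_def using k
    by (simp only: sum_quadratic) (simp add: half_int_def k' field_simps power2_eq_square)
qed

lemmas bracket_simps = fun_eq_iff mat_bracket_def sum_bool n2_rep_simps half_int_def field_simps
  cocycle_Lgen cocycle_Hgen cocycle_Lgen_Hgen cocycle_Hgen_Lgen

lemma n2_op_bracket_aux:
  assumes k: "n2_shift a + n2_shift b = 0 \<Longrightarrow> 0 \<le> n2_shift a"
  shows "n2_op a (n2_op b w) - sg (n2_odd a) (n2_odd b) *\<^sub>C n2_op b (n2_op a w) =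
    n2_rep (n2_gen_bracket a b) w"
proof (cases "a = Cgen \<or> b = Cgen")
  case True
  then show ?thesis
    by (cases a; cases b) (auto simp: n2_rep_0 complex_vector.linear_scale[OF clinear_n2_op] mult.commute)
next
  case False
  then show ?thesis
  \<comment> \<open>Coefficients and targets are read off the defining relations. Where the bracket
    has no noncentral part, both coefficients are 0 and the targets merely carry the total
    shift.\<close>
  proof (cases a; cases b)
    fix n m assume ab: "a = Lgen n" "b = Lgen m"
    show ?thesis
      unfolding ab
      by (rule quad_bracket_eqI[where d = "Lgen (n + m)" and d' = "Lgen (n + m)" and c = "of_int (n - m)" and c' = "0"])
        (use k ab in \<open>auto simp: bracket_simps simp flip: n2_op_eq\<close>)
  next
    fix n m assume ab: "a = Lgen n" "b = Hgen m"
    show ?thesis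
      unfolding ab
      by (rule quad_bracket_eqI[where d = "Hgen (n + m)" and d' = "Hgen (n + m)" and c = "- of_int m" and c' = "0"])
        (use k ab in \<open>auto simp: bracket_simps simp flip: n2_op_eq\<close>)
  next
    fix n m assume ab: "a = Hgen n" "b = Lgen m"
    show ?thesis
      unfolding ab
      by (rule quad_bracket_eqI[where d = "Hgen (n + m)" and d' = "Hgen (n + m)" and c = "of_int n" and c' = "0"])
        (use k ab in \<open>auto simp: bracket_simps simp flip: n2_op_eq\<close>)
  next
    \<comment> \<open>One even and one odd generator: unfolding \<open>cocycle_def\<close> makes
      every summand vanish.\<close>
    fix n m assume ab: "a = Lgen n" "b = Gplus m"
    show ?thesis
      unfolding ab
      by (rule quad_bracket_eqI[where d = "Gplus (n + m)" and d' = "Gplus (n + m)" and c = "of_int n / 2 - half_int m" and c' = "0"])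
        (use k ab in \<open>auto simp: bracket_simps cocycle_def simp flip: n2_op_eq\<close>)
  next
    fix n m assume ab: "a = Gplus n" "b = Lgen m"
    show ?thesis
      unfolding ab
      by (rule quad_bracket_eqI[where d = "Gplus (n + m)" and d' = "Gplus (n + m)" and c = "- (of_int m / 2 - half_int n)" and c' = "0"])
        (use k ab in \<open>auto simp: bracket_simps cocycle_def simp flip: n2_op_eq\<close>)
  next
    fix n m assume ab: "a = Lgen n" "b = Gminus m"
    show ?thesis
      unfolding ab
      by (rule quad_bracket_eqI[where d = "Gminus (n + m)" and d' = "Gminus (n + m)" and c = "of_int n / 2 - half_int m" and c' = "0"])
        (use k ab in \<open>auto simp: bracket_simps cocycle_def simp flip: n2_op_eq\<close>)
  next
    fix n m assume ab: "a = Gminus n" "b = Lgen m"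
    show ?thesis
      unfolding ab
      by (rule quad_bracket_eqI[where d = "Gminus (n + m)" and d' = "Gminus (n + m)" and c = "- (of_int m / 2 - half_int n)" and c' = "0"])
        (use k ab in \<open>auto simp: bracket_simps cocycle_def simp flip: n2_op_eq\<close>)
  next
    fix n m assume ab: "a = Hgen n" "b = Hgen m"
    show ?thesis
      unfolding ab
      by (rule quad_bracket_eqI[where d = "Hgen (n + m)" and d' = "Hgen (n + m)" and c = "0" and c' = "0"])
        (use k ab in \<open>auto simp: bracket_simps simp flip: n2_op_eq\<close>)
  next
    fix n m assume ab: "a = Hgen n" "b = Gplus m"
    show ?thesis
      unfolding ab
      by (rule quad_bracket_eqI[where d = "Gplus (n + m)" and d' = "Gplus (n + m)" and c = "1" and c' = "0"])
        (use k ab in \<open>auto simp: bracket_simps cocycle_def simp flip: n2_op_eq\<close>)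
  next
    fix n m assume ab: "a = Gplus n" "b = Hgen m"
    show ?thesis
      unfolding ab
      by (rule quad_bracket_eqI[where d = "Gplus (n + m)" and d' = "Gplus (n + m)" and c = "- 1" and c' = "0"])
        (use k ab in \<open>auto simp: bracket_simps cocycle_def simp flip: n2_op_eq\<close>)
  next
    fix n m assume ab: "a = Hgen n" "b = Gminus m"
    show ?thesis
      unfolding ab
      by (rule quad_bracket_eqI[where d = "Gminus (n + m)" and d' = "Gminus (n + m)" and c = "- 1" and c' = "0"])
        (use k ab in \<open>auto simp: bracket_simps cocycle_def simp flip: n2_op_eq\<close>)
  next
    fix n m assume ab: "a = Gminus n" "b = Hgen m"
    show ?thesis
      unfolding ab
      by (rule quad_bracket_eqI[where d = "Gminus (n + m)" and d' = "Gminus (n + m)" and c = "1" and c' = "0"])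
        (use k ab in \<open>auto simp: bracket_simps cocycle_def simp flip: n2_op_eq\<close>)
  next
    fix n m assume ab: "a = Gplus n" "b = Gminus m"
    show ?thesis
      unfolding ab
      by (rule quad_bracket_eqI[where d = "Lgen (n + m + 1)" and d' = "Hgen (n + m + 1)" and c = "2" and c' = "half_int n - half_int m"])
        (use k ab in \<open>auto simp: bracket_simps n2_bracket_Gplus_Gminus_def cocycle_Gplus_Gminus simp flip: n2_op_eq\<close>)
  next
    fix n m assume ab: "a = Gminus n" "b = Gplus m"
    show ?thesis
      unfolding ab
      by (rule quad_bracket_eqI[where d = "Lgen (m + n + 1)" and d' = "Hgen (m + n + 1)" and c = "2" and c' = "half_int m - half_int n"])
        (use k ab in \<open>auto simp: bracket_simps n2_bracket_Gplus_Gminus_def cocycle_Gminus_Gplus simp flip: n2_op_eq\<close>)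
  next
    fix n m assume ab: "a = Gplus n" "b = Gplus m"
    show ?thesis
      unfolding ab
      by (rule quad_bracket_eqI[where d = "Lgen (n + m + 2)" and d' = "Lgen (n + m + 2)" and c = "0" and c' = "0"])
        (use k ab in \<open>auto simp: bracket_simps cocycle_def simp flip: n2_op_eq\<close>)
  next
    fix n m assume ab: "a = Gminus n" "b = Gminus m"
    show ?thesis
      unfolding ab
      by (rule quad_bracket_eqI[where d = "Lgen (n + m)" and d' = "Lgen (n + m)" and c = "0" and c' = "0"])
        (use k ab in \<open>auto simp: bracket_simps cocycle_def simp flip: n2_op_eq\<close>)
  qed auto
qed

text \<open>If the shifts add up to 0 and that of \<open>a\<close> is negative, that of
  \<open>b\<close> is positive, and both sides are super antisymmetric in \<open>a\<close> and
  \<open>b\<close>.\<close>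

lemma n2_op_bracket:
  "n2_rep (n2_gen_bracket a b) w =
    n2_op a (n2_op b w) - sg (n2_odd a) (n2_odd b) *\<^sub>C n2_op b (n2_op a w)"
proof (cases "n2_shift a + n2_shift b = 0 \<longrightarrow> 0 \<le> n2_shift a")
  case True
  then show ?thesis
    by (intro n2_op_bracket_aux[symmetric]) simp
next
  case False
  then have "n2_op b (n2_op a w) - sg (n2_odd b) (n2_odd a) *\<^sub>C n2_op a (n2_op b w) =
      n2_rep (n2_gen_bracket b a) w"
    by (intro n2_op_bracket_aux) auto
  then have "n2_rep (n2_gen_bracket a b) w = - (sg (n2_odd b) (n2_odd a) *\<^sub>C
      (n2_op b (n2_op a w) - sg (n2_odd b) (n2_odd a) *\<^sub>C n2_op a (n2_op b w)))"
    by (simp only: n2_gen_bracket_commute[of a b] n2_rep_scale n2_rep_minus)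
  then show ?thesis
    by (simp add: complex_vector.scale_right_diff_distrib sg_commute[of "n2_odd b"] scaleC_one)
qed

end

section \<open>Bilinear extension and compatibility with parity\<close>

lemma clinear_n2_bracket: "clinear (\<lambda>x. n2_bracket x y)" "clinear (n2_bracket x)"
proof -
  show "clinear (\<lambda>x. n2_bracket x y)"
    unfolding n2_bracket_def by (rule clinear_lin_ext)
  show "clinear (n2_bracket x)"
    unfolding n2_bracket_def
    by unfold_locales
      (simp_all add: lin_ext_def[where p = x] lin_ext_add lin_ext_scale
        scaleC_add_right sum.distrib complex_vector.scale_sum_right mult.commute)
qed

lemma n2_bracket_basis: "n2_bracket (n2_basis a) (n2_basis b) = n2_gen_bracket a b"
  by (simp add: n2_bracket_def scaleC_one)

locale super_fock_module = fock_module I X Y vac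
  for I :: "'i set" and X Y :: "bool \<Rightarrow> 'i \<Rightarrow> int \<Rightarrow> 'w::complex_vector \<Rightarrow> 'w" and vac :: 'w +
  fixes W :: "bit \<Rightarrow> 'w set"
  assumes subspace_W: "csubspace (W j)"
    and X_W: "w \<in> W j \<Longrightarrow> X s i n w \<in> W (of_bool s + j)"
    and Y_W: "w \<in> W j \<Longrightarrow> Y s i n w \<in> W (of_bool s + j)"
begin

lemma normal_ord_W:
  assumes "w \<in> W j"
  shows "normal_ord s t i q p w \<in> W (of_bool (s \<noteq> t) + j)"
proof -
  have "X s i q (Y t i p w) \<in> W (of_bool s + (of_bool t + j))"
    "Y t i p (X s i q w) \<in> W (of_bool t + (of_bool s + j))"
    using assms by (intro X_W Y_W; assumption)+
  moreover have "of_bool s + (of_bool t + j) = of_bool (s \<noteq> t) + j"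
    "of_bool t + (of_bool s + j) = of_bool (s \<noteq> t) + j"
    by (simp_all only: add.assoc[symmetric] sum_of_bool_bit eq_commute[of t])
  ultimately show ?thesis
    using subspace_W by (simp add: normal_ord_def complex_vector.subspace_scale)
qed

lemma quad_W:
  assumes A: "has_parity e A" and w: "w \<in> W j"
  shows "quad A k w \<in> W (of_bool e + j)"
proof -
  obtain J where J: "bounds k w J"
    using bounds_exists by blast
  have "A s t p *\<^sub>C normal_ord s t i (p + k) p w \<in> W (of_bool e + j)" for s t i p
  proof (cases "(s \<noteq> t) = e")
    case True
    then show ?thesis
      unfolding True[symmetric] by (intro complex_vector.subspace_scale subspace_W normal_ord_W w)
  next
    case False
    then show ?thesis
      using A subspace_W by (simp add: has_parity_def complex_vector.subspace_0)
  qed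
  then show ?thesis
    unfolding quad_eq[OF J] by (intro complex_vector.subspace_sum subspace_W)
qed

lemma n2_op_W:
  assumes "w \<in> W j"
  shows "n2_op a w \<in> W (n2_gen_parity a + j)"
proof (cases "a = Cgen")
  case True
  then show ?thesis
    using complex_vector.subspace_scale[OF subspace_W assms]
    by (simp only: n2_op.simps n2_gen_parity.simps add_0)
next
  case False
  have "of_bool (n2_odd a) = n2_gen_parity a"
    by (cases a) simp_all
  then show ?thesis
    using quad_W[OF has_parity_n2_mat assms, of a] False by (simp add: n2_op_eq)
qed

lemma n2_rep_W:
  assumes "x \<in> n2_part i" "w \<in> W j"
  shows "n2_rep x w \<in> W (i + j)"
  using assms(1) unfolding n2_part_def
proof (induction rule: complex_vector.span_induct_alt)
  case base
  then show ?case
    using subspace_W by (simp add: n2_rep_0 complex_vector.subspace_0)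
next
  case (step c x y)
  then obtain a where "x = n2_basis a" "n2_gen_parity a = i"
    by blast
  then have "n2_rep x w \<in> W (i + j)"
    using n2_op_W[OF assms(2), of a] by (simp only: n2_rep_basis)
  then show ?case
    unfolding n2_rep_add n2_rep_scale
    by (intro complex_vector.subspace_add complex_vector.subspace_scale subspace_W step.IH)
qed

text \<open>The sign depends on \<open>i\<close> and \<open>j\<close> only, so both sides are
  bilinear on the homogeneous parts: span induction on \<open>y\<close> for a basis element in the
  first slot, then on \<open>x\<close>.\<close>

lemma n2_rep_bracket:
  assumes x: "x \<in> n2_part i" and y: "y \<in> n2_part j"
  shows "n2_rep (n2_bracket x y) w =
    n2_rep x (n2_rep y w) - (if i = 1 \<and> j = 1 then - 1 else 1) *\<^sub>C n2_rep y (n2_rep x w)"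
proof -
  let ?e = "(if i = 1 \<and> j = 1 then - 1 else 1) :: complex"
  note rep = complex_vector.linear_add[OF clinear_n2_rep] complex_vector.linear_scale[OF clinear_n2_rep]
    complex_vector.linear_0[OF clinear_n2_rep]
  note br = complex_vector.linear_add[OF clinear_n2_bracket(1)] complex_vector.linear_scale[OF clinear_n2_bracket(1)]
    complex_vector.linear_0[OF clinear_n2_bracket(1)]
    complex_vector.linear_add[OF clinear_n2_bracket(2)] complex_vector.linear_scale[OF clinear_n2_bracket(2)]
    complex_vector.linear_0[OF clinear_n2_bracket(2)]
  note simps = rep br n2_rep_simps scaleC_add_right complex_vector.scale_right_diff_distrib
  have gen: "n2_rep (n2_bracket (n2_basis a) y) w = n2_op a (n2_rep y w) - ?e *\<^sub>C n2_rep y (n2_op a w)"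
    if a: "n2_gen_parity a = i" for a
    using y unfolding n2_part_def
  proof (induction rule: complex_vector.span_induct_alt)
    case base
    then show ?case
      by (simp add: simps complex_vector.linear_0[OF clinear_n2_op])
  next
    case (step c x y)
    then obtain b where b: "x = n2_basis b" "n2_gen_parity b = j"
      by blast
    have "sg (n2_odd a) (n2_odd b) = ?e"
      using a b by (simp add: sg_def n2_odd_def)
    then have "n2_rep (n2_gen_bracket a b) w = n2_op a (n2_op b w) - ?e *\<^sub>C n2_op b (n2_op a w)"
      using n2_op_bracket[of a b w] by simp
    then show ?case
      unfolding b(1)
      by (simp only: simps n2_bracket_basis step.IH complex_vector.linear_add[OF clinear_n2_op]
          complex_vector.linear_scale[OF clinear_n2_op])
        (simp add: algebra_simps)
  qed
  show ?thesis
    using x unfolding n2_part_def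
  proof (induction rule: complex_vector.span_induct_alt)
    case base
    then show ?case
      by (simp add: simps)
  next
    case (step c x z)
    then obtain a where a: "x = n2_basis a" "n2_gen_parity a = i"
      by blast
    show ?case
      unfolding a(1) using gen[OF a(2)]
      by (simp only: simps step.IH) (simp add: algebra_simps)
  qed
qed

theorem n2_representation_n2_rep: "n2_representation W n2_rep"
  unfolding n2_representation_def superrep_def
  using clinear_n2_rep n2_rep_W n2_rep_bracket
  by (auto simp: n2_rep_def clinear_lin_ext)

theorem has_central_charge_n2_rep: "has_central_charge n2_rep (3 * of_nat (card I))"
  by (simp add: has_central_charge_def n2_rep_basis)

end

section \<open>Tensor products and the induced modules\<close>

lemma poly_mapping_induct [case_names single add]:
  fixes p :: "'a \<Rightarrow>\<^sub>0 'b::comm_monoid_add"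
  assumes single: "\<And>k v. P (Poly_Mapping.single k v)" and add: "\<And>f g. P f \<Longrightarrow> P g \<Longrightarrow> P (f + g)"
  shows "P p"
proof -
  have "P (\<Sum>k\<in>A. Poly_Mapping.single k (Poly_Mapping.lookup p k))" for A
    using single[of undefined 0] by (induction A rule: infinite_finite_induct) (simp_all add: single add)
  then show ?thesis
    by (subst poly_mapping_sum_single)
qed

lemma cong_mod_base: "x - y \<in> N \<Longrightarrow> cong_mod N x y"
  unfolding cong_mod_def by (rule complex_vector.span_base)

lemma tensor_add_left: "(x + x') \<otimes>\<^sub>C y = x \<otimes>\<^sub>C y + x' \<otimes>\<^sub>C y"
  by transfer (rule cong_mod_base, unfold tensor_rels_def Let_def diff_diff_add[symmetric], blast)

lemma tensor_add_right: "x \<otimes>\<^sub>C (y + y') = x \<otimes>\<^sub>C y + x \<otimes>\<^sub>C y'"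
  by transfer (rule cong_mod_base, unfold tensor_rels_def Let_def diff_diff_add[symmetric], blast)

lemma tensor_scale_left: "(c *\<^sub>C x) \<otimes>\<^sub>C y = c *\<^sub>C (x \<otimes>\<^sub>C y)"
  by transfer (rule cong_mod_base, unfold tensor_rels_def Let_def, blast)

lemma tensor_scale_right: "x \<otimes>\<^sub>C (c *\<^sub>C y) = c *\<^sub>C (x \<otimes>\<^sub>C y)"
  by transfer (rule cong_mod_base, unfold tensor_rels_def Let_def, blast)

lemma clinear_tensor: "clinear (\<lambda>x. x \<otimes>\<^sub>C y)" "clinear (tensor x)"
  by (auto intro!: clinearI simp: tensor_add_left tensor_add_right tensor_scale_left tensor_scale_right)

lemma tensor_zero_right: "x \<otimes>\<^sub>C 0 = 0"
  by (rule complex_vector.linear_0[OF clinear_tensor(2)])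

text \<open>Scalars get no case of their own: they are absorbed into the left factor.\<close>

lemma tensor_induct [case_names simple add]:
  assumes simple: "\<And>x y. P (x \<otimes>\<^sub>C y)" and add: "\<And>s t. P s \<Longrightarrow> P t \<Longrightarrow> P (s + t)"
  shows "P t"
proof (induction t rule: tensor.abs_induct)
  case (1 p)
  show ?case
  proof (induction p rule: poly_mapping_induct)
    case (single k v)
    obtain x y where k: "k = (x, y)"
      by (cases k)
    have "abs_tensor (Poly_Mapping.single k v) = v *\<^sub>C (x \<otimes>\<^sub>C y)"
      by (simp add: tensor.abs_eq scaleC_tensor.abs_eq scaleC_single k)
    then show ?case
      using simple[of "v *\<^sub>C x" y] by (simp add: tensor_scale_left)
  next
    case (add f g)
    then show ?case
      using assms(2) by (metis plus_tensor.abs_eq)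
  qed
qed

text \<open>Goes through a representative because \<open>f\<close> and \<open>g\<close> are
  arbitrary functions here; for linear ones \<open>tensor_map_abs\<close> shows that the choice is
  immaterial.\<close>

definition tensor_map ::
    "('a::complex_vector \<Rightarrow> 'c::complex_vector) \<Rightarrow> ('b::complex_vector \<Rightarrow> 'd::complex_vector)
      \<Rightarrow> ('a, 'b) tensor \<Rightarrow> ('c, 'd) tensor"
  where "tensor_map f g t = abs_tensor (lin_ext (\<lambda>(x, y). Poly_Mapping.single (f x, g y) 1) (rep_tensor t))"

lemma tensor_map_abs:
  fixes f :: "'a::complex_vector \<Rightarrow> 'c::complex_vector" and g :: "'b::complex_vector \<Rightarrow> 'd::complex_vector"
  assumes "clinear f" "clinear g"
  shows "tensor_map f g (abs_tensor p) = abs_tensor (lin_ext (\<lambda>(x, y). Poly_Mapping.single (f x, g y) 1) p)"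
proof -
  let ?F = "lin_ext (\<lambda>(x, y). Poly_Mapping.single (f x, g y) (1 :: complex))"
  interpret F: Vector_Spaces.linear scaleC scaleC ?F
    by (rule clinear_lin_ext)
  have "cong_mod tensor_rels (rep_tensor (abs_tensor p)) p"
    using tensor.abs_eq_iff Quotient3_abs_rep[OF Quotient3_tensor] by metis
  then have "cong_mod tensor_rels (?F (rep_tensor (abs_tensor p))) (?F p)"
  proof (rule cong_mod_linear[OF clinear_lin_ext, rotated])
    fix r :: "('a \<times> 'b) \<Rightarrow>\<^sub>0 complex" assume "r \<in> tensor_rels"
    then have "?F r \<in> tensor_rels"
      unfolding tensor_rels_def Let_def
      by (elim UnE CollectE exE conjE)
        (simp add: F.diff F.scale scaleC_one complex_vector.linear_add[OF assms(1)] complex_vector.linear_scale[OF assms(1)]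
          complex_vector.linear_add[OF assms(2)] complex_vector.linear_scale[OF assms(2)]; blast)+
    then show "?F r \<in> cspan tensor_rels"
      by (rule complex_vector.span_base)
  qed
  then show ?thesis
    by (simp add: tensor_map_def tensor.abs_eq_iff)
qed

lemma tensor_map_simple:
  assumes "clinear f" "clinear g"
  shows "tensor_map f g (x \<otimes>\<^sub>C y) = f x \<otimes>\<^sub>C g y"
  by (simp add: tensor.abs_eq tensor_map_abs[OF assms] scaleC_one)

lemma clinear_tensor_map:
  assumes "clinear f" "clinear g"
  shows "clinear (tensor_map f g)"
proof (rule clinearI)
  fix s t c
  show "tensor_map f g (s + t) = tensor_map f g s + tensor_map f g t"
    by (induction s rule: tensor.abs_induct, induction t rule: tensor.abs_induct)
      (simp add: plus_tensor.abs_eq tensor_map_abs[OF assms] lin_ext_add)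
  show "tensor_map f g (c *\<^sub>C s) = c *\<^sub>C tensor_map f g s"
    by (induction s rule: tensor.abs_induct)
      (simp add: scaleC_tensor.abs_eq tensor_map_abs[OF assms] lin_ext_scale)
qed

text \<open>Words are built letter by letter from the left, the form that suits subspaces stable
  under the action of the generators.\<close>

lemma tensor_algebra_induct [case_names one gen_mult add scale]:
  fixes P :: "'u::complex_vector tensor_algebra \<Rightarrow> bool"
  assumes one: "P 1" and gen_mult: "\<And>u a. P a \<Longrightarrow> P (tensor_gen u * a)"
    and add: "\<And>a b. P a \<Longrightarrow> P b \<Longrightarrow> P (a + b)" and scale: "\<And>c a. P a \<Longrightarrow> P (c *\<^sub>C a)"
  shows "P a"
proof (induction a rule: tensor_algebra.abs_induct)
  case (1 p)
  show ?case
  proof (induction p rule: poly_mapping_induct)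
    case (single k v)
    obtain us where k: "k = Word us"
      by (cases k)
    have "P (abs_tensor_algebra (Poly_Mapping.single (Word us) 1))"
    proof (induction us)
      case Nil
      have "abs_tensor_algebra (Poly_Mapping.single (Word ([] :: 'u list)) 1) = 1"
        by (simp add: one_tensor_algebra.abs_eq flip: zero_word_def)
      then show ?case
        using one by simp
    next
      case (Cons u us)
      have "abs_tensor_algebra (Poly_Mapping.single (Word (u # us)) 1) =
          tensor_gen u * abs_tensor_algebra (Poly_Mapping.single (Word us) 1)"
        by (simp add: tensor_gen.abs_eq times_tensor_algebra.abs_eq free_gen_def mult_single)
      then show ?case
        using gen_mult Cons.IH by simp
    qed
    from assms(4)[OF this, of v] show ?case
      by (simp add: scaleC_tensor_algebra.abs_eq scaleC_single k)
  next
    case (add f g)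
    then show ?case
      using assms(3) by (metis plus_tensor_algebra.abs_eq)
  qed
qed

lemma ideal_gens_base: "r \<in> R \<Longrightarrow> r \<in> ideal_gens R"
  unfolding ideal_gens_def by (force intro: exI[of _ 1])

lemma clinear_tensor_gen: "clinear tensor_gen"
proof (rule clinearI)
  fix u w :: 'a and c
  show "tensor_gen (u + w) = tensor_gen u + tensor_gen w"
    by transfer (rule cong_mod_base, rule ideal_gens_base, unfold tensor_algebra_rels_def diff_diff_add[symmetric], blast)
  show "tensor_gen (c *\<^sub>C u) = c *\<^sub>C tensor_gen u"
    by transfer (rule cong_mod_base, rule ideal_gens_base, unfold tensor_algebra_rels_def, blast)
qed

section \<open>Left multiplication as an algebra action\<close>

lemma lmult_tensor_mult: "lmult_tensor (a * b) x = lmult_tensor a (lmult_tensor b x)"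
  by (induction x rule: tensor_induct)
    (simp_all add: mult.assoc complex_vector.linear_add[OF clinear_lmult_tensor])

lemma lmult_tensor_add: "lmult_tensor (a + b) x = lmult_tensor a x + lmult_tensor b x"
  by (induction x rule: tensor_induct)
    (simp_all add: distrib_right tensor_add_left complex_vector.linear_add[OF clinear_lmult_tensor] algebra_simps)

lemma lmult_tensor_scale: "lmult_tensor (c *\<^sub>C a) x = c *\<^sub>C lmult_tensor a x"
  by (induction x rule: tensor_induct)
    (simp_all add: mult_scaleC_left tensor_scale_left scaleC_add_right complex_vector.linear_add[OF clinear_lmult_tensor])

lemma lmult_tensor_one: "lmult_tensor 1 x = x"
  by (induction x rule: tensor_induct)
    (simp_all add: complex_vector.linear_add[OF clinear_lmult_tensor])

section \<open>The Heisenberg algebra and its induced module\<close>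

lemma clinear_heisenberg_gen: "clinear heisenberg_gen"
  by (rule clinearI)
    (simp_all add: heisenberg_gen_def complex_vector.linear_add[OF clinear_tensor_gen]
      complex_vector.linear_scale[OF clinear_tensor_gen] plus_heisenberg.abs_eq scaleC_heisenberg.abs_eq)

lemma heisenberg_gen_mult:
  "heisenberg_gen u * heisenberg_gen w = heisenberg_gen w * heisenberg_gen u + skew_form u w *\<^sub>C 1"
proof -
  have "cong_mod (ideal_gens heisenberg_rels) (tensor_gen u * tensor_gen w)
      ((tensor_gen w * tensor_gen u) + skew_form u w *\<^sub>C 1)"
    by (rule cong_mod_base, rule ideal_gens_base)
      (unfold heisenberg_rels_def, rule CollectI, rule exI[of _ u], rule exI[of _ w], simp add: algebra_simps)
  then show ?thesis
    by (simp add: heisenberg_gen_def times_heisenberg.abs_eq one_heisenberg.abs_eq scaleC_heisenberg.abs_eq plus_heisenberg.abs_eq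
        uminus_heisenberg.abs_eq heisenberg.abs_eq_iff)
qed

lemma heisenberg_induct [case_names one gen_mult add scale]:
  assumes "P 1" "\<And>u a. P a \<Longrightarrow> P (heisenberg_gen u * a)"
    "\<And>a b. P a \<Longrightarrow> P b \<Longrightarrow> P (a + b)" "\<And>c a. P a \<Longrightarrow> P (c *\<^sub>C a)"
  shows "P a"
proof (induction a rule: heisenberg.abs_induct)
  case (1 t)
  show ?case
    by (induction t rule: tensor_algebra_induct)
      (use assms in \<open>simp_all flip: one_heisenberg.abs_eq times_heisenberg.abs_eq plus_heisenberg.abs_eq
        scaleC_heisenberg.abs_eq heisenberg_gen_def\<close>)
qed

lemma clinear_heisenberg_act: "clinear (heisenberg_act a)"
proof (rule clinearI)
  fix x y c
  show "heisenberg_act a (x + y) = heisenberg_act a x + heisenberg_act a y"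
    by (induction x rule: semi_inf_sym.abs_induct, induction y rule: semi_inf_sym.abs_induct)
      (simp add: plus_semi_inf_sym.abs_eq heisenberg_act.abs_eq complex_vector.linear_add[OF clinear_lmult_tensor])
  show "heisenberg_act a (c *\<^sub>C x) = c *\<^sub>C heisenberg_act a x"
    by (induction x rule: semi_inf_sym.abs_induct)
      (simp add: scaleC_semi_inf_sym.abs_eq heisenberg_act.abs_eq complex_vector.linear_scale[OF clinear_lmult_tensor])
qed

lemma heisenberg_act_mult: "heisenberg_act (a * b) x = heisenberg_act a (heisenberg_act b x)"
  by (induction x rule: semi_inf_sym.abs_induct) (simp add: heisenberg_act.abs_eq lmult_tensor_mult)

lemma heisenberg_act_add: "heisenberg_act (a + b) x = heisenberg_act a x + heisenberg_act b x"
  by (induction x rule: semi_inf_sym.abs_induct)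
    (simp add: heisenberg_act.abs_eq lmult_tensor_add plus_semi_inf_sym.abs_eq)

lemma heisenberg_act_scale: "heisenberg_act (c *\<^sub>C a) x = c *\<^sub>C heisenberg_act a x"
  by (induction x rule: semi_inf_sym.abs_induct)
    (simp add: heisenberg_act.abs_eq lmult_tensor_scale scaleC_semi_inf_sym.abs_eq)

lemma heisenberg_act_minus: "heisenberg_act (- a) x = - heisenberg_act a x"
  using heisenberg_act_scale[of "- 1" a x] by (simp add: scaleC_one)

lemma heisenberg_act_one: "heisenberg_act 1 x = x"
  by (induction x rule: semi_inf_sym.abs_induct) (simp add: heisenberg_act.abs_eq lmult_tensor_one)

lemma heisenberg_act_gen_gen:
  "heisenberg_act (heisenberg_gen u) (heisenberg_act (heisenberg_gen w) x) =
    heisenberg_act (heisenberg_gen w) (heisenberg_act (heisenberg_gen u) x) + skew_form u w *\<^sub>C x"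
  by (simp only: heisenberg_act_mult[symmetric] heisenberg_gen_mult[of u w] heisenberg_act_add heisenberg_act_scale heisenberg_act_one
      mult_minus_left heisenberg_act_minus)

definition sym_vacuum :: "'v::graded_complex_vector semi_inf_sym"
  where "sym_vacuum = abs_semi_inf_sym (1 \<otimes>\<^sub>C 1)"

lemma heisenberg_act_annihilators:
  fixes u :: "'v::graded_complex_vector double"
  assumes "u \<in> annihilators"
  shows "heisenberg_act (heisenberg_gen u) sym_vacuum = 0"
proof -
  from assms have "trivial_rep (heisenberg_gen ` annihilators) (heisenberg_gen u) 0"
    by (intro trivial_rep.intros imageI)
  \<comment> \<open>The induction relation with \<open>h = 1\<close>, \<open>z = 1\<close> and the
    scalar 0, left unsimplified so that it matches \<open>induction_rels_def\<close>.\<close>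
  then have "(1 * heisenberg_gen u) \<otimes>\<^sub>C (1 :: complex) - 1 \<otimes>\<^sub>C (0 * 1) \<in> induction_rels (heisenberg_gen ` annihilators)"
    unfolding induction_rels_def by blast
  then have "cong_mod (induction_rels (heisenberg_gen ` annihilators)) (heisenberg_gen u \<otimes>\<^sub>C 1) 0"
    by (intro cong_mod_base) (simp add: tensor_zero_right)
  then show ?thesis
    by (simp add: sym_vacuum_def heisenberg_act.abs_eq zero_semi_inf_sym_def semi_inf_sym.abs_eq_iff)
qed

text \<open>The simple tensor of \<open>a\<close> and \<open>z\<close> is
  \<open>z *\<^sub>C a\<close> applied to the vacuum; sums follow by additivity of the
  action.\<close>

lemma semi_inf_sym_cyclic: "\<exists>a. x = heisenberg_act a sym_vacuum"
proof (induction x rule: semi_inf_sym.abs_induct)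
  case (1 t)
  show ?case
  proof (induction t rule: tensor_induct)
    case (simple a z)
    have "heisenberg_act (z *\<^sub>C a) sym_vacuum = abs_semi_inf_sym (a \<otimes>\<^sub>C z)"
      using tensor_scale_right[of a z "1 :: complex"]
      by (simp add: sym_vacuum_def heisenberg_act.abs_eq tensor_scale_left)
    then show ?case
      by metis
  next
    case (add s t)
    then show ?case
      by (metis heisenberg_act_add plus_semi_inf_sym.abs_eq)
  qed
qed

section \<open>The Clifford algebra and its induced module, in parallel\<close>

lemma clinear_clifford_gen: "clinear clifford_gen"
  by (rule clinearI)
    (simp_all add: clifford_gen_def complex_vector.linear_add[OF clinear_tensor_gen]
      complex_vector.linear_scale[OF clinear_tensor_gen] plus_clifford.abs_eq scaleC_clifford.abs_eq)

lemma clifford_gen_mult: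
  "clifford_gen u * clifford_gen w = - clifford_gen w * clifford_gen u + sym_form u w *\<^sub>C 1"
proof -
  have "cong_mod (ideal_gens clifford_rels) (tensor_gen u * tensor_gen w)
      (- (tensor_gen w * tensor_gen u) + sym_form u w *\<^sub>C 1)"
    by (rule cong_mod_base, rule ideal_gens_base)
      (unfold clifford_rels_def, rule CollectI, rule exI[of _ u], rule exI[of _ w], simp add: algebra_simps)
  then show ?thesis
    by (simp add: clifford_gen_def times_clifford.abs_eq one_clifford.abs_eq scaleC_clifford.abs_eq plus_clifford.abs_eq
        uminus_clifford.abs_eq clifford.abs_eq_iff)
qed

lemma clifford_induct [case_names one gen_mult add scale]:
  assumes "P 1" "\<And>u a. P a \<Longrightarrow> P (clifford_gen u * a)"
    "\<And>a b. P a \<Longrightarrow> P b \<Longrightarrow> P (a + b)" "\<And>c a. P a \<Longrightarrow> P (c *\<^sub>C a)"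
  shows "P a"
proof (induction a rule: clifford.abs_induct)
  case (1 t)
  show ?case
    by (induction t rule: tensor_algebra_induct)
      (use assms in \<open>simp_all flip: one_clifford.abs_eq times_clifford.abs_eq plus_clifford.abs_eq
        scaleC_clifford.abs_eq clifford_gen_def\<close>)
qed

lemma clinear_clifford_act: "clinear (clifford_act a)"
proof (rule clinearI)
  fix x y c
  show "clifford_act a (x + y) = clifford_act a x + clifford_act a y"
    by (induction x rule: semi_inf_ext.abs_induct, induction y rule: semi_inf_ext.abs_induct)
      (simp add: plus_semi_inf_ext.abs_eq clifford_act.abs_eq complex_vector.linear_add[OF clinear_lmult_tensor])
  show "clifford_act a (c *\<^sub>C x) = c *\<^sub>C clifford_act a x"
    by (induction x rule: semi_inf_ext.abs_induct)
      (simp add: scaleC_semi_inf_ext.abs_eq clifford_act.abs_eq complex_vector.linear_scale[OF clinear_lmult_tensor])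
qed

lemma clifford_act_mult: "clifford_act (a * b) x = clifford_act a (clifford_act b x)"
  by (induction x rule: semi_inf_ext.abs_induct) (simp add: clifford_act.abs_eq lmult_tensor_mult)

lemma clifford_act_add: "clifford_act (a + b) x = clifford_act a x + clifford_act b x"
  by (induction x rule: semi_inf_ext.abs_induct)
    (simp add: clifford_act.abs_eq lmult_tensor_add plus_semi_inf_ext.abs_eq)

lemma clifford_act_scale: "clifford_act (c *\<^sub>C a) x = c *\<^sub>C clifford_act a x"
  by (induction x rule: semi_inf_ext.abs_induct)
    (simp add: clifford_act.abs_eq lmult_tensor_scale scaleC_semi_inf_ext.abs_eq)

lemma clifford_act_minus: "clifford_act (- a) x = - clifford_act a x"
  using clifford_act_scale[of "- 1" a x] by (simp add: scaleC_one)

lemma clifford_act_one: "clifford_act 1 x = x"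
  by (induction x rule: semi_inf_ext.abs_induct) (simp add: clifford_act.abs_eq lmult_tensor_one)

lemma clifford_act_gen_gen:
  "clifford_act (clifford_gen u) (clifford_act (clifford_gen w) x) =
    - clifford_act (clifford_gen w) (clifford_act (clifford_gen u) x) + sym_form u w *\<^sub>C x"
  by (simp only: clifford_act_mult[symmetric] clifford_gen_mult[of u w] clifford_act_add clifford_act_scale clifford_act_one
      mult_minus_left clifford_act_minus)

lemma clifford_act_annihilators:
  fixes u :: "'v::graded_complex_vector double"
  assumes "u \<in> annihilators"
  shows "clifford_act (clifford_gen u) ext_vacuum = 0"
proof -
  from assms have "trivial_rep (clifford_gen ` annihilators) (clifford_gen u) 0"
    by (intro trivial_rep.intros imageI)
  then have "(1 * clifford_gen u) \<otimes>\<^sub>C (1 :: complex) - 1 \<otimes>\<^sub>C (0 * 1) \<in> induction_rels (clifford_gen ` annihilators)"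
    unfolding induction_rels_def by blast
  then have "cong_mod (induction_rels (clifford_gen ` annihilators)) (clifford_gen u \<otimes>\<^sub>C 1) 0"
    by (intro cong_mod_base) (simp add: tensor_zero_right)
  then show ?thesis
    by (simp add: ext_vacuum_def clifford_act.abs_eq zero_semi_inf_ext_def semi_inf_ext.abs_eq_iff)
qed

lemma semi_inf_ext_cyclic: "\<exists>a. x = clifford_act a ext_vacuum"
proof (induction x rule: semi_inf_ext.abs_induct)
  case (1 t)
  show ?case
  proof (induction t rule: tensor_induct)
    case (simple a z)
    have "clifford_act (z *\<^sub>C a) ext_vacuum = abs_semi_inf_ext (a \<otimes>\<^sub>C z)"
      using tensor_scale_right[of a z "1 :: complex"]
      by (simp add: ext_vacuum_def clifford_act.abs_eq tensor_scale_left)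
    then show ?case
      by metis
  next
    case (add s t)
    then show ?case
      by (metis clifford_act_add plus_semi_inf_ext.abs_eq)
  qed
qed

section \<open>Mode operators on the Weil module\<close>

text \<open>No Koszul sign appears: the symmetric factor is even, and the parity is carried by the
  exterior factor alone.\<close>

definition weil_op :: "bool \<Rightarrow> 'v::graded_complex_vector double \<Rightarrow> 'v weil \<Rightarrow> 'v weil"
  where "weil_op s u =
    (if s then tensor_map (\<lambda>x. x) (clifford_act (clifford_gen u)) else tensor_map (heisenberg_act (heisenberg_gen u)) (\<lambda>x. x))"

definition weil_vacuum :: "'v::graded_complex_vector weil"
  where "weil_vacuum = sym_vacuum \<otimes>\<^sub>C ext_vacuum"

definition weil_form :: "bool \<Rightarrow> 'v::graded_complex_vector double \<Rightarrow> 'v double \<Rightarrow> complex"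
  where "weil_form s = (if s then sym_form else skew_form)"

lemma clinear_weil_op: "clinear (weil_op s u)"
  by (simp add: weil_op_def clinear_tensor_map clinear_heisenberg_act clinear_clifford_act complex_vector.linear_ident)

lemma weil_op_simple:
  "weil_op False u (x \<otimes>\<^sub>C y) = heisenberg_act (heisenberg_gen u) x \<otimes>\<^sub>C y"
  "weil_op True u (x \<otimes>\<^sub>C y) = x \<otimes>\<^sub>C clifford_act (clifford_gen u) y"
  by (simp_all add: weil_op_def tensor_map_simple clinear_heisenberg_act clinear_clifford_act complex_vector.linear_ident)

lemmas weil_op_linear =
  complex_vector.linear_add[OF clinear_weil_op] complex_vector.linear_scale[OF clinear_weil_op]
  complex_vector.linear_0[OF clinear_weil_op]

lemma tensor_diff_right: "x \<otimes>\<^sub>C (y - z) = x \<otimes>\<^sub>C y - x \<otimes>\<^sub>C z"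
  by (rule complex_vector.linear_diff[OF clinear_tensor(2)])

text \<open>Operators of different parity act on different factors and commute; those of equal
  parity obey the Heisenberg or the Clifford relation.\<close>

lemma weil_op_weil_op:
  "weil_op s u (weil_op t w x) = sg s t *\<^sub>C weil_op t w (weil_op s u x) + (if s = t then weil_form s u w else 0) *\<^sub>C x"
proof (induction x rule: tensor_induct)
  case (simple x y)
  show ?case
    by (cases s; cases t)
      (simp_all add: weil_op_simple heisenberg_act_gen_gen[of u w] clifford_act_gen_gen[of u w]
        tensor_add_left tensor_add_right tensor_scale_left tensor_scale_right tensor_diff_right
        weil_form_def scaleC_one)
next
  case (add x y)
  then show ?case
    by (simp only: weil_op_linear scaleC_add_right add_ac)
qed

lemma clinear_weil_op_gen: "clinear (\<lambda>u. weil_op s u x)"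
proof (rule clinearI)
  fix u w c
  show "weil_op s (u + w) x = weil_op s u x + weil_op s w x"
    by (induction x rule: tensor_induct; cases s)
      (simp_all add: weil_op_simple weil_op_linear complex_vector.linear_add[OF clinear_heisenberg_gen]
        complex_vector.linear_add[OF clinear_clifford_gen] heisenberg_act_add clifford_act_add
        tensor_add_left tensor_add_right algebra_simps)
  show "weil_op s (c *\<^sub>C u) x = c *\<^sub>C weil_op s u x"
    by (induction x rule: tensor_induct; cases s)
      (simp_all add: weil_op_simple weil_op_linear complex_vector.linear_scale[OF clinear_heisenberg_gen]
        complex_vector.linear_scale[OF clinear_clifford_gen] heisenberg_act_scale clifford_act_scale
        tensor_scale_left tensor_scale_right scaleC_add_right)
qed

lemma tensor_zero_left: "0 \<otimes>\<^sub>C x = 0"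
  by (rule complex_vector.linear_0[OF clinear_tensor(1)])

lemma weil_op_vacuum: "u \<in> annihilators \<Longrightarrow> weil_op s u weil_vacuum = 0"
  by (cases s)
    (simp_all add: weil_vacuum_def weil_op_simple heisenberg_act_annihilators clifford_act_annihilators
      tensor_zero_left tensor_zero_right)

text \<open>The exterior factor is generated first, over the symmetric vacuum, and then the
  symmetric factor over an arbitrary exterior one.\<close>

lemma weil_cyclic:
  fixes S :: "'v::graded_complex_vector weil set"
  assumes S: "csubspace S" and vac: "weil_vacuum \<in> S" and op: "\<And>s u w. w \<in> S \<Longrightarrow> weil_op s u w \<in> S"
  shows "w \<in> S"
proof -
  note closed = complex_vector.subspace_add[OF S] complex_vector.subspace_scale[OF S]
  have ext: "sym_vacuum \<otimes>\<^sub>C clifford_act a ext_vacuum \<in> S" for a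
  proof (induction a rule: clifford_induct)
    case one
    then show ?case using vac by (simp add: weil_vacuum_def clifford_act_one)
  next
    case (gen_mult u a)
    then show ?case using op[of _ True u] by (simp add: clifford_act_mult flip: weil_op_simple)
  qed (simp_all add: clifford_act_add clifford_act_scale tensor_add_right tensor_scale_right closed)
  have sym: "heisenberg_act a sym_vacuum \<otimes>\<^sub>C clifford_act b ext_vacuum \<in> S" for a b
  proof (induction a rule: heisenberg_induct)
    case one
    then show ?case using ext by (simp add: heisenberg_act_one)
  next
    case (gen_mult u a)
    then show ?case using op[of _ False u] by (simp add: heisenberg_act_mult flip: weil_op_simple)
  qed (simp_all add: heisenberg_act_add heisenberg_act_scale tensor_add_left tensor_scale_left closed)
  show ?thesis
  proof (induction w rule: tensor_induct)
    case (simple x y)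
    then show ?case
      using sym semi_inf_sym_cyclic[of x] semi_inf_ext_cyclic[of y] by auto
  qed (rule closed)
qed

lemma clifford_act_ext_part:
  assumes "y \<in> ext_part j"
  shows "clifford_act (clifford_gen u) y \<in> ext_part (1 + j)"
  using assms unfolding ext_part_def
proof (induction rule: complex_vector.span_induct_alt)
  case base
  show ?case
    by (simp add: complex_vector.linear_0[OF clinear_clifford_act] complex_vector.span_zero)
next
  case (step c x y)
  then obtain us where us: "x = clifford_act (prod_list (map clifford_gen us)) ext_vacuum" "of_nat (length us) = j"
    by blast
  have "of_nat (length (u # us)) = 1 + j"
    using us(2) by (simp only: list.size of_nat_Suc add.commute) simp
  moreover have "clifford_act (clifford_gen u) x = clifford_act (prod_list (map clifford_gen (u # us))) ext_vacuum"
    by (simp add: us(1) clifford_act_mult)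
  ultimately have "clifford_act (clifford_gen u) x \<in>
      {clifford_act (prod_list (map clifford_gen us)) ext_vacuum | us. of_nat (length us) = 1 + j}"
    by blast
  then show ?case
    unfolding complex_vector.linear_add[OF clinear_clifford_act] complex_vector.linear_scale[OF clinear_clifford_act]
    by (intro complex_vector.span_add complex_vector.span_scale step.IH complex_vector.span_base)
qed

lemma weil_op_weil_part:
  assumes "w \<in> weil_part j"
  shows "weil_op s u w \<in> weil_part (of_bool s + j)"
  using assms unfolding weil_part_def
proof (induction rule: complex_vector.span_induct_alt)
  case base
  show ?case
    by (simp add: weil_op_linear complex_vector.span_zero)
next
  case (step c x y)
  then obtain a b where x: "x = a \<otimes>\<^sub>C b" "b \<in> ext_part j"
    by blast
  have "weil_op s u x \<in> {a \<otimes>\<^sub>C b | a b. b \<in> ext_part (of_bool s + j)}"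
  proof (cases s)
    case True
    then have s: "s = True" by simp
    show ?thesis
      using clifford_act_ext_part[OF x(2), of u] unfolding x(1) s weil_op_simple of_bool_eq by blast
  next
    case False
    then have s: "s = False" by simp
    show ?thesis
      using x(2) unfolding x(1) s weil_op_simple of_bool_eq add_0 by blast
  qed
  then show ?case
    unfolding weil_op_linear
    by (intro complex_vector.span_add complex_vector.span_scale step.IH complex_vector.span_base)
qed

section \<open>The loop space and its restricted dual in coordinates\<close>

lemma loop_induct [case_names monom add]:
  assumes monom: "\<And>n v. P (loop_monom n v)" and add: "\<And>x y. P x \<Longrightarrow> P y \<Longrightarrow> P (x + y)"
  shows "P (x :: 'v::complex_vector loop)"
proof -
  have 0: "P 0"
    using monom[of 0 0] complex_vector.linear_0[OF clinear_loop_monom] by metis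
  have "loop_coeff x m = loop_coeff (\<Sum>n | loop_coeff x n \<noteq> 0. loop_monom n (loop_coeff x n)) m" for m
    using loop_coeff[of x] by (auto simp: loop_coeff_sum loop_monom.rep_eq)
  then have "x = (\<Sum>n | loop_coeff x n \<noteq> 0. loop_monom n (loop_coeff x n))"
    by (intro iffD2[OF loop_eq_iff] allI)
  moreover have "P (\<Sum>n\<in>N. loop_monom n (loop_coeff x n))" for N
    by (induction N rule: infinite_finite_induct) (simp_all add: 0 monom add)
  ultimately show ?thesis
    by metis
qed

text \<open>The test for linearity makes this total: a nonlinear \<open>\<phi>\<close> is sent to
  the zero functional, which lies in the restricted dual.\<close>

lift_definition loop_dual :: "int \<Rightarrow> ('v::fd_complex_vector \<Rightarrow> complex) \<Rightarrow> 'v loop rdual"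
  is "\<lambda>n \<phi> x. if clinear \<phi> then \<phi> (loop_coeff x n) else 0"
proof (intro conjI)
  fix n and \<phi> :: "'v \<Rightarrow> complex"
  let ?f = "\<lambda>x. if clinear \<phi> then \<phi> (loop_coeff x n) else 0"
  show "clinear ?f"
    by (rule clinearI)
      (simp_all add: plus_loop.rep_eq scaleC_loop.rep_eq complex_vector.linear_add complex_vector.linear_scale)
  have "{m. \<exists>x\<in>grade m. ?f x \<noteq> 0} \<subseteq> {n}"
    by (auto simp: grade_loop_def loop_monom.rep_eq complex_vector.linear_0 split: if_splits)
  then show "finite {m. \<exists>x\<in>grade m. ?f x \<noteq> 0}"
    by (rule finite_subset) simp
qed

lemma loop_dual_monom:
  "clinear \<phi> \<Longrightarrow> rdual_apply (loop_dual n \<phi>) (loop_monom m v) = (if m = n then \<phi> v else 0)"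
  by (simp add: loop_dual.rep_eq loop_monom.rep_eq complex_vector.linear_0)

lemma clinear_rdual_apply: "clinear (rdual_apply f)"
  using rdual_apply[of f] by simp

lemma rdual_eqI:
  fixes f g :: "'v::fd_complex_vector loop rdual"
  assumes "\<And>n v. rdual_apply f (loop_monom n v) = rdual_apply g (loop_monom n v)"
  shows "f = g"
proof -
  have "rdual_apply f x = rdual_apply g x" for x
    by (induction x rule: loop_induct)
      (simp_all add: assms complex_vector.linear_add[OF clinear_rdual_apply])
  then show ?thesis
    by (simp add: rdual_apply_inject[symmetric] fun_eq_iff)
qed

lemma rdual_apply_sum: "rdual_apply (\<Sum>a\<in>A. f a) x = (\<Sum>a\<in>A. rdual_apply (f a) x)"
  by (induction A rule: infinite_finite_induct) (simp_all add: zero_rdual.rep_eq plus_rdual.rep_eq)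

lemma loop_dual_annihilates: "n \<le> 0 \<Longrightarrow> (0, loop_dual n \<phi>) \<in> annihilators"
  unfolding annihilators_def
  by (auto simp: complex_vector.span_zero dual_grade_def grade_loop_def loop_dual.rep_eq loop_monom.rep_eq
      complex_vector.linear_0 intro!: complex_vector.span_base bexI[of _ n])

lemma loop_monom_annihilates: "0 < n \<Longrightarrow> (loop_monom n v, 0) \<in> annihilators"
  unfolding annihilators_def
  by (auto simp: complex_vector.span_zero grade_loop_def intro!: complex_vector.span_base bexI[of _ n])

theorem theorem3p2:
  shows "\<exists>\<rho> :: n2 \<Rightarrow> ('v::fd_complex_vector) loop weil \<Rightarrow> 'v loop weil.
    n2_representation weil_part \<rho> \<and> has_central_charge \<rho> (3 * of_nat (cdim (UNIV :: 'v set)))"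
proof -
  obtain B :: "'v set" where indep: "\<not> cdependent B" and span: "UNIV \<subseteq> cspan B" and card: "card B = cdim (UNIV :: 'v set)"
    by (rule complex_vector.basis_exists[of UNIV])
  obtain B' :: "'v set" where B': "finite B'" "cspan B' = UNIV"
    using finite_dimensional[where 'a = 'v] by (auto simp: complex_vector.span_finite)
  have fin: "finite B"
    using complex_vector.independent_span_bound[OF B'(1) indep] B'(2) by simp
  have in_span: "v \<in> cspan B" for v
    using span by blast
  define coord where "coord b v = crepresentation B v b" for b v
  have coord: "clinear (coord b)" for b
    unfolding coord_def
    by (rule clinearI) (simp_all add: complex_vector.representation_add[OF indep in_span in_span]
        complex_vector.representation_scale[OF indep in_span])
  have coord_basis: "coord b c = (if b = c then 1 else 0)" if "c \<in> B" for b c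
    using that by (simp add: coord_def complex_vector.representation_basis[OF indep])
  have coord_sum: "(\<Sum>b\<in>B. coord b v *\<^sub>C b) = v" for v
    unfolding coord_def by (rule complex_vector.sum_representation_eq[OF indep in_span fin subset_refl])
  \<comment> \<open>With a functional on the left and a vector on the right, the skew and the
    symmetric form agree, so both parities get the same contraction.\<close>
  define x :: "int \<Rightarrow> 'v \<Rightarrow> 'v loop double" where "x n v = (loop_monom n v, 0)" for n v
  define y where "y n b = (0 :: 'v loop, loop_dual n (coord b))" for n b
  define X where "X s v n = weil_op s (x n v)" for s v n
  define Y where "Y s b n = weil_op s (y n b)" for s b n
  note form_simps = weil_form_def sym_form_def skew_form_def x_def y_def zero_rdual.rep_eq
    complex_vector.linear_0[OF clinear_rdual_apply]
  interpret super_fock_module B X Y "weil_vacuum :: 'v loop weil" weil_part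
  proof (intro super_fock_module.intro fock_module.intro super_fock_module_axioms.intro)
    show "finite B" by (rule fin)
  next
    fix s t :: bool and v u :: 'v and m n :: int and w :: "'v loop weil"
    show "clinear (X s v n)" "clinear (Y s v n)"
      unfolding X_def Y_def by (rule clinear_weil_op)+
    show "X s v m (X t u n w) = sg s t *\<^sub>C X t u n (X s v m w)"
      unfolding X_def weil_op_weil_op[of s "x m v"] by (simp add: form_simps)
    show "Y s v m (Y t u n w) = sg s t *\<^sub>C Y t u n (Y s v m w)"
      unfolding Y_def weil_op_weil_op[of s "y m v"] by (simp add: form_simps)
    show "Y s v m (X t u n w) = sg s t *\<^sub>C X t u n (Y s v m w) + (if s = t \<and> v = u \<and> m = n then w else 0)"
      if "v \<in> B" "u \<in> B"
      unfolding X_def Y_def weil_op_weil_op[of s "y m v"]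
      using that by (auto simp: form_simps loop_dual_monom[OF coord] coord_basis scaleC_one)
    show "X s v n weil_vacuum = 0" if "0 < n"
      unfolding X_def x_def by (rule weil_op_vacuum[OF loop_monom_annihilates[OF that]])
    show "Y s v n weil_vacuum = 0" if "n \<le> 0"
      unfolding Y_def y_def by (rule weil_op_vacuum[OF loop_dual_annihilates[OF that]])
  next
    fix S :: "'v loop weil set" and w
    assume S: "csubspace S" and vac: "weil_vacuum \<in> S"
      and X: "\<And>s i n w. i \<in> B \<Longrightarrow> w \<in> S \<Longrightarrow> X s i n w \<in> S"
      and Y: "\<And>s i n w. i \<in> B \<Longrightarrow> w \<in> S \<Longrightarrow> Y s i n w \<in> S"
    show "w \<in> S"
      using S vac
    proof (rule weil_cyclic)
      \<comment> \<open>Stability under the modes of the basis implies stability under every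
        \<open>u\<close>: the loop part and the dual part of \<open>u\<close> are expanded
        separately.\<close>
      fix s w and u :: "'v loop double" assume w: "w \<in> S"
      note lin = complex_vector.linear_add[OF clinear_weil_op_gen]
        complex_vector.linear_scale[OF clinear_weil_op_gen] complex_vector.linear_sum[OF clinear_weil_op_gen]
      obtain f g where u: "u = (f, g)" by (cases u)
      have "weil_op s (f, 0) w \<in> S"
      proof (induction f rule: loop_induct)
        case (monom n v)
        have "(loop_monom n v, 0) = (\<Sum>b\<in>B. coord b v *\<^sub>C x n b)"
        proof -
          have "loop_monom n v = (\<Sum>b\<in>B. coord b v *\<^sub>C loop_monom n b)"
            by (subst coord_sum[of v, symmetric])
              (simp only: complex_vector.linear_sum[OF clinear_loop_monom] complex_vector.linear_scale[OF clinear_loop_monom])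
          then show ?thesis
            by (simp add: prod_eq_iff x_def fst_sum snd_sum scaleC_prod_def)
        qed
        then show ?case
          using X w by (simp add: lin X_def complex_vector.subspace_sum[OF S] complex_vector.subspace_scale[OF S])
      next
        case (add f f')
        have "(f + f', 0 :: 'v loop rdual) = (f, 0) + (f', 0)"
          by simp
        then show ?case
          using add complex_vector.subspace_add[OF S] by (metis lin(1))
      qed
      moreover have "weil_op s (0, g) w \<in> S"
      proof -
        \<comment> \<open>A restricted functional lives in finitely many degrees; in each of them it
          is expanded in the dual basis.\<close>
        let ?N = "{n. \<exists>x\<in>grade n. rdual_apply g x \<noteq> 0}"
        have N: "finite ?N"
          using rdual_apply[of g] by simp
        have g_eq: "g = (\<Sum>n\<in>?N. \<Sum>b\<in>B. rdual_apply g (loop_monom n b) *\<^sub>C loop_dual n (coord b))"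
        proof (rule rdual_eqI)
          fix m v
          have "rdual_apply g (loop_monom m v) = (\<Sum>b\<in>B. coord b v * rdual_apply g (loop_monom m b))"
            by (subst coord_sum[of v, symmetric])
              (simp only: complex_vector.linear_sum[OF clinear_loop_monom] complex_vector.linear_scale[OF clinear_loop_monom]
                complex_vector.linear_sum[OF clinear_rdual_apply] complex_vector.linear_scale[OF clinear_rdual_apply] scaleC_complex_def)
          moreover have "rdual_apply g (loop_monom m v) = 0" if "m \<notin> ?N"
            using that by (auto simp: grade_loop_def)
          moreover have "(\<Sum>b\<in>B. rdual_apply g (loop_monom n b) * rdual_apply (loop_dual n (coord b)) (loop_monom m v)) =
              (if m = n then \<Sum>b\<in>B. coord b v * rdual_apply g (loop_monom m b) else 0)" for n
            by (simp add: loop_dual_monom[OF coord] mult.commute)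
          ultimately show "rdual_apply g (loop_monom m v) =
              rdual_apply (\<Sum>n\<in>?N. \<Sum>b\<in>B. rdual_apply g (loop_monom n b) *\<^sub>C loop_dual n (coord b)) (loop_monom m v)"
            using N by (simp only: rdual_apply_sum scaleC_rdual.rep_eq scaleC_complex_def sum.delta') presburger
        qed
        have "(\<Sum>n\<in>?N. \<Sum>b\<in>B. rdual_apply g (loop_monom n b) *\<^sub>C y n b) =
            (0, \<Sum>n\<in>?N. \<Sum>b\<in>B. rdual_apply g (loop_monom n b) *\<^sub>C loop_dual n (coord b))"
          by (simp add: prod_eq_iff y_def fst_sum snd_sum scaleC_prod_def)
        also have "\<dots> = (0, g)"
          using g_eq by (intro arg_cong[where f = "Pair 0"]) (rule sym)
        finally have "weil_op s (0, g) w = weil_op s (\<Sum>n\<in>?N. \<Sum>b\<in>B. rdual_apply g (loop_monom n b) *\<^sub>C y n b) w"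
          by (intro arg_cong[where f = "\<lambda>u. weil_op s u w"]) (rule sym)
        also have "\<dots> = (\<Sum>n\<in>?N. \<Sum>b\<in>B. rdual_apply g (loop_monom n b) *\<^sub>C Y s b n w)"
          by (simp only: lin Y_def)
        finally have "weil_op s (0, g) w = \<dots>" .
        then show ?thesis
          using Y w by (simp add: complex_vector.subspace_sum[OF S] complex_vector.subspace_scale[OF S])
      qed
      moreover have "u = (f, 0) + (0, g)"
        by (simp add: u)
      ultimately show "weil_op s u w \<in> S"
        using complex_vector.subspace_add[OF S] by (simp only: lin)
    qed
  next
    fix j
    show "csubspace (weil_part j :: 'v loop weil set)"
      by (simp add: weil_part_def complex_vector.subspace_span)
  next
    fix w :: "'v loop weil" and j s v n
    assume "w \<in> weil_part j"
    then show "X s v n w \<in> weil_part (of_bool s + j)" "Y s v n w \<in> weil_part (of_bool s + j)"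
      unfolding X_def Y_def by (rule weil_op_weil_part)+
  qed
  show ?thesis
    using n2_representation_n2_rep has_central_charge_n2_rep unfolding card by blast
qed

end
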